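(* Let $\phi \in H^{\infty}(\mathbb{C}^+)$ and $\alpha \in \mathbb{C}$. Then the boundary function $y \mapsto \phi(iy)$ is almost convergent to $\alpha$, that is, $$\lim_{\theta \to \infty} \frac{1}{2\theta} \int_{y-\theta}^{y+\theta} \phi(it)\,dt = \alpha$$ uniformly in $y \in \mathbb{R}$, if and only if $$\lim_{x \to \infty} \phi(x+iy) = \alpha$$ uniformly in $y \in \mathbb{R}$.
   Context: $\mathbb{C}^+ = \{z \in \mathbb{C} : \mathrm{Re}(z) > 0\}$ is the right half plane and $H^{\infty}(\mathbb{C}^+)$ is the space of bounded analytic functions on $\mathbb{C}^+$. Each $\phi \in H^{\infty}(\mathbb{C}^+)$ has nontangential boundary limits $\phi(iy) = \lim_{x \to 0^+} \phi(x+iy)$ for almost every $y \in \mathbb{R}$; the function $y \mapsto \phi(iy)$ in $L^{\infty}(\mathbb{R})$ is the boundary function of $\phi$. Almost convergence: let $P(\mathbb{R})$ be the set of $f \in L^1(\mathbb{R})$ with $f \ge 0$ and $\int_{\mathbb{R}} f = 1$. A mean on $L^{\infty}(\mathbb{R})$ is an element $\Phi \in L^{\infty}(\mathbb{R})^*$ with $\Phi(\psi) \ge 0$ whenever $\psi \ge 0$ and $\Phi(1)=1$; it is topologically invariant if $\Phi(f * \psi) = \Phi(\psi)$ for every $f \in P(\mathbb{R})$ and $\psi \in L^{\infty}(\mathbb{R})$, where $(f*\psi)(x) = \int_{\mathbb{R}} \psi(x-t) f(t)\,dt$. A function $\psi \in L^{\infty}(\mathbb{R})$ is almost convergent to $\alpha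 \in \mathbb{C}$ if $\Phi(\psi) = \alpha$ for every topologically invariant mean $\Phi$. *)

theory Defs
  imports "HOL-Complex_Analysis.Complex_Analysis" "HOL-Probability.Essential_Supremum"
begin

definition right_half_plane :: "complex set"  (\<open>\<complex>\<^sup>+\<close>) where
  "\<complex>\<^sup>+ = {z. Re z > 0}"

definition Hinfty :: "(complex \<Rightarrow> complex) set" where
  "Hinfty = {\<phi>. \<phi> holomorphic_on \<complex>\<^sup>+ \<and> bounded (\<phi> ` \<complex>\<^sup>+)}"

text \<open>
  For \<open>\<phi>\<close> in \<open>Hinfty\<close> the limit exists for almost every \<open>y\<close> (Fatou); at the remaining
  \<open>y\<close> the value of \<open>Lim\<close> is an unspecified constant, which is irrelevant for elements of
  \<open>L\<^sup>\<infinity>(\<real>)\<close>.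
\<close>
definition boundary_fun :: "(complex \<Rightarrow> complex) \<Rightarrow> real \<Rightarrow> complex" where
  "boundary_fun \<phi> y = Lim (at_right 0) (\<lambda>x. \<phi> (Complex x y))"

text \<open>
  Elements of \<open>L\<^sup>\<infinity>(\<real>)\<close> are represented by functions; functionals on \<open>L\<^sup>\<infinity>(\<real>)\<close> are
  functionals on representatives that do not distinguish functions equal almost everywhere
  and whose values outside \<open>Linfty\<close> are unconstrained.
\<close>
definition Linfty :: "(real \<Rightarrow> complex) set" where
  "Linfty = {\<psi>. \<psi> \<in> borel_measurable lebesgue \<and>
                 esssup lebesgue (\<lambda>x. ereal (norm (\<psi> x))) < \<infinity>}"

definition Linfty_norm :: "(real \<Rightarrow> complex) \<Rightarrow> real" where
  "Linfty_norm \<psi> = real_of_ereal (esssup lebesgue (\<lambda>x. ereal (norm (\<psi> x))))"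

definition Linfty_dual :: "((real \<Rightarrow> complex) \<Rightarrow> complex) set" where
  "Linfty_dual = {\<Phi>.
     (\<forall>\<psi>\<in>Linfty. \<forall>\<eta>\<in>Linfty. (AE x in lebesgue. \<psi> x = \<eta> x) \<longrightarrow> \<Phi> \<psi> = \<Phi> \<eta>) \<and>
     (\<forall>\<psi>\<in>Linfty. \<forall>\<eta>\<in>Linfty. \<Phi> (\<lambda>x. \<psi> x + \<eta> x) = \<Phi> \<psi> + \<Phi> \<eta>) \<and>
     (\<forall>c. \<forall>\<psi>\<in>Linfty. \<Phi> (\<lambda>x. c * \<psi> x) = c * \<Phi> \<psi>) \<and>
     (\<exists>C. \<forall>\<psi>\<in>Linfty. norm (\<Phi> \<psi>) \<le> C * Linfty_norm \<psi>)}"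

definition is_mean :: "((real \<Rightarrow> complex) \<Rightarrow> complex) \<Rightarrow> bool" where
  "is_mean \<Phi> \<longleftrightarrow> \<Phi> \<in> Linfty_dual \<and>
     (\<forall>\<psi>\<in>Linfty. (AE x in lebesgue. \<psi> x \<in> \<real>\<^sub>\<ge>\<^sub>0) \<longrightarrow> \<Phi> \<psi> \<in> \<real>\<^sub>\<ge>\<^sub>0) \<and>
     \<Phi> (\<lambda>x. 1) = 1"

definition prob_densities :: "(real \<Rightarrow> real) set" where
  "prob_densities = {f. integrable lebesgue f \<and> (AE x in lebesgue. f x \<ge> 0) \<and>
                        integral\<^sup>L lebesgue f = 1}"

definition convol :: "(real \<Rightarrow> real) \<Rightarrow> (real \<Rightarrow> complex) \<Rightarrow> real \<Rightarrow> complex" where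
  "convol f \<psi> x = (LINT t|lebesgue. \<psi> (x - t) * complex_of_real (f t))"

definition topologically_invariant_mean :: "((real \<Rightarrow> complex) \<Rightarrow> complex) \<Rightarrow> bool" where
  "topologically_invariant_mean \<Phi> \<longleftrightarrow> is_mean \<Phi> \<and>
     (\<forall>f\<in>prob_densities. \<forall>\<psi>\<in>Linfty. \<Phi> (convol f \<psi>) = \<Phi> \<psi>)"

definition almost_convergent :: "(real \<Rightarrow> complex) \<Rightarrow> complex \<Rightarrow> bool" where
  "almost_convergent \<psi> \<alpha> \<longleftrightarrow>
     \<psi> \<in> Linfty \<and> (\<forall>\<Phi>. topologically_invariant_mean \<Phi> \<longrightarrow> \<Phi> \<psi> = \<alpha>)"

end

theory Submission
  imports Defs "HOL-Probability.Sinc_Integral"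
begin

text \<open>
  Let \<open>K\<close> be an almost everywhere continuous probability density. A bounded \<open>\<psi>\<close> is almost
  convergent to \<open>\<alpha>\<close> iff its averages \<open>\<integral> K(s) \<psi>(y - \<theta> s) ds\<close> tend to \<open>\<alpha>\<close> uniformly in \<open>y\<close> as
  \<open>\<theta> \<rightarrow> \<infinity>\<close>: an invariant mean takes the same value at \<open>\<psi>\<close> and at its averages, and conversely
  every pointwise cluster point of the averaging functionals at \<open>(\<theta>\<^sub>n, y\<^sub>n)\<close> with \<open>\<theta>\<^sub>n \<rightarrow> \<infinity>\<close> is an
  invariant mean. The uniform density on \<open>[-1, 1]\<close> gives the Cesaro means, and the Poisson
  kernel gives \<open>\<phi>(\<theta> + i y)\<close>.

  The Poisson formula needs Fatou's theorem. A primitive of \<open>\<phi>\<close> is Lipschitz, so it extends to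
  the imaginary axis, where it is differentiable almost everywhere. Integrating the Poisson formula
  by parts expresses \<open>\<phi>(x + i y)\<close> through difference quotients of the primitive at \<open>y\<close> on scale
  \<open>x\<close>, and these converge at every point of differentiability.
\<close>

section \<open>Differentiability of Lipschitz functions\<close>

text \<open>The two limits in the theorem are never compared with each other: each is compared with
  the values of all invariant means, so one equivalence, stated for a kernel \<open>K\<close>,
  serves twice. Uniformity in y enters through the freedom to pick a bad centre y for every scale.
  Continuity of \<open>K\<close> almost everywhere makes its translates converge in L1, which is
  what turns cluster points of the averages into invariant means. Such a cluster point must handle
  all bounded functions at once, an uncountable index set, so it is a limit along a filter finer
  than \<open>sequentially\<close> rather than along a subsequence.

  The formula is therefore first proved with the line Re z = e as boundary, and then rewritten with
  a primitive, whose limits exist at every boundary point. The price is a factor growing like |s|;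
  the derivative of the Poisson kernel, of order 1/|s|^3, pays for it.\<close>

text \<open>Vitali's covering theorem picks countably many disjoint intervals from the fine cover,
  and countable additivity adds up the inequalities on them. Keeping the intervals inside
  \<open>V\<close> allows both outer approximation and nesting of two such coverings.\<close>

lemma vitali_compare:
  fixes M N :: "real measure"
  assumes [measurable_cong]: "sets M = sets borel" "sets N = sets borel"
    and V: "open V" "E \<subseteq> V"
    and fine: "\<And>x d. x \<in> E \<Longrightarrow> 0 < d \<Longrightarrow>
      \<exists>a b. a < x \<and> x < b \<and> b - a < d \<and> emeasure M {a<..<b} \<le> emeasure N {a<..<b}"
  obtains U where "open U" "U \<subseteq> V" "negligible (E - U)" "emeasure M U \<le> emeasure N U"
proof -
  \<comment> \<open>Intervals are indexed by their endpoints, while \<open>c\<close> and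
    \<open>r\<close> present them as closed balls, the form in which the covering theorem is
    applied.\<close>
  define K where "K = {(a, b). a < b \<and> cball ((a + b) / 2) ((b - a) / 2) \<subseteq> V \<and>
    emeasure M {a<..<b} \<le> emeasure N {a<..<b}}"
  define c where "c = (\<lambda>(a, b). (a + b) / 2 :: real)"
  define r where "r = (\<lambda>(a, b). (b - a) / 2 :: real)"
  have cb: "cball (c i) (r i) = {fst i..snd i}" for i
    by (cases i) (auto simp: c_def r_def cball_eq_atLeastAtMost field_simps)
  have ex: "\<exists>i. i \<in> K \<and> x \<in> cball (c i) (r i) \<and> r i < d" if x: "x \<in> E" and d: "0 < d" for x d
  proof -
    obtain e where e: "e > 0" "ball x e \<subseteq> V"
      using V x by (meson open_contains_ball subsetD)
    obtain a b where ab: "a < x" "x < b" "b - a < min d e"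
        "emeasure M {a<..<b} \<le> emeasure N {a<..<b}"
      using fine[OF x, of "min d e"] e d by auto
    have "{a..b} \<subseteq> V"
      using ab e(2) by (force simp: ball_def dist_real_def subset_iff)
    then have "(a, b) \<in> K"
      using ab cb[of "(a, b)"] by (auto simp: K_def c_def r_def)
    moreover have "x \<in> cball (c (a, b)) (r (a, b))" using ab by (simp add: cb)
    moreover have "r (a, b) < d" using ab d by (simp add: r_def)
    ultimately show ?thesis by blast
  qed
  obtain C where C: "countable C" "C \<subseteq> K"
    "pairwise (\<lambda>i j. disjnt (cball (c i) (r i)) (cball (c j) (r j))) C"
    "negligible (E - (\<Union>i\<in>C. cball (c i) (r i)))"
  proof (rule Vitali_covering_theorem_cballs[of K r E c])
    show "0 < r i" if "i \<in> K" for i using that by (auto simp: K_def r_def)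
  qed (use ex in auto)
  define I where "I = (\<lambda>i::real \<times> real. {fst i<..<snd i})"
  define U where "U = (\<Union>i\<in>C. I i)"
  have disj: "disjoint_family_on I C"
    using C(3) unfolding disjoint_family_on_def pairwise_def I_def cb disjnt_def by fastforce
  have [measurable]: "I i \<in> sets M" "I i \<in> sets N" for i
    by (auto simp: I_def assms(1,2))
  show thesis
  proof
    show "open U" by (auto simp: U_def I_def)
    show "U \<subseteq> V"
      using C(2) unfolding U_def I_def K_def
      by (force simp: cball_eq_atLeastAtMost field_simps)
    \<comment> \<open>Passing from the selected closed intervals to open ones loses only their
      endpoints, a countable set.\<close>
    have "E - U \<subseteq> (E - (\<Union>i\<in>C. cball (c i) (r i))) \<union> (fst ` C \<union> snd ` C)"
      unfolding U_def I_def cb by force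
    moreover have "negligible (fst ` C \<union> snd ` C)"
      using C(1) unfolding negligible_iff_null_sets
      by (intro null_sets_completionI countable_imp_null_set_lborel countable_Un countable_image)
    ultimately show "negligible (E - U)"
      using C(4) by (meson negligible_Un negligible_subset)
    have "emeasure M U = (\<integral>\<^sup>+i. emeasure M (I i) \<partial>count_space C)"
      unfolding U_def by (rule emeasure_UN_countable[OF _ C(1) disj]) simp
    also have "\<dots> \<le> (\<integral>\<^sup>+i. emeasure N (I i) \<partial>count_space C)"
      using C(2) by (intro nn_integral_mono) (auto simp: K_def I_def)
    also have "\<dots> = emeasure N U"
      unfolding U_def by (rule emeasure_UN_countable[OF _ C(1) disj, symmetric]) simp
    finally show "emeasure M U \<le> emeasure N U" .
  qed
qed

lemma emeasure_interval_measure_Ioo: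
  assumes "a \<le> b" and mono: "\<And>x y. x \<le> y \<Longrightarrow> F x \<le> F y" and cont: "continuous_on UNIV F"
  shows "emeasure (interval_measure F) {a<..<b} = ennreal (F b - F a)"
proof (cases "a = b")
  case False
  have "emeasure (interval_measure F) {b} = 0"
    using emeasure_interval_measure_Icc[OF order_refl mono cont, of b] by simp
  then have "{b} \<in> null_sets (interval_measure F)" by (auto simp: null_sets_def)
  then have "emeasure (interval_measure F) ({a<..<b} \<union> {b}) = emeasure (interval_measure F) {a<..<b}"
    by (intro emeasure_Un_null_set) auto
  moreover have "{a<..<b} \<union> {b} = {a<..b}" using assms(1) False by auto
  moreover have "emeasure (interval_measure F) {a<..b} = F b - F a"
    using assms by (intro emeasure_interval_measure_Ioc)
      (auto simp: continuous_on_eq_continuous_within intro: continuous_within_subset)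
  ultimately show ?thesis by simp
qed simp

text \<open>The intervals straddle the point instead of ending there, and \<open>P\<close> sees
  increment and length separately to avoid division. With \<open>q * v \<le> u\<close> membership
  forces the upper derivate over intervals around the point to be at least q; with
  \<open>u \<le> p * v\<close> the lower one is at most p.\<close>

definition fine_slopes :: "(real \<Rightarrow> real) \<Rightarrow> (real \<Rightarrow> real \<Rightarrow> bool) \<Rightarrow> real set" where
  "fine_slopes G P = {x. \<forall>d>0. \<exists>a b. a < x \<and> x < b \<and> b - a < d \<and> P (G b - G a) (b - a)}"

text \<open>For each length bound 1/(n+1) the points straddled by an admissible interval form a
  union of open intervals. The set is thus a G_delta, whatever \<open>G\<close> and \<open>P\<close>
  are.\<close>

lemma fine_slopes_borel [measurable]: "fine_slopes G P \<in> sets borel"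
proof -
  define W where "W = (\<lambda>n. \<Union>(a, b)\<in>{(a, b). b - a < 1 / real (Suc n) \<and> P (G b - G a) (b - a)}. {a<..<b})"
  have "fine_slopes G P = (\<Inter>n. W n)"
  proof (intro equalityI subsetI)
    fix x assume x: "x \<in> fine_slopes G P"
    have "x \<in> W n" for n
    proof -
      have "(0::real) < 1 / real (Suc n)" by simp
      then obtain a b where "a < x" "x < b" "b - a < 1 / real (Suc n)" "P (G b - G a) (b - a)"
        using x unfolding fine_slopes_def by blast
      then show ?thesis unfolding W_def by (auto intro!: bexI[of _ "(a, b)"] simp del: of_nat_Suc)
    qed
    then show "x \<in> (\<Inter>n. W n)" by blast
  next
    fix x assume x: "x \<in> (\<Inter>n. W n)"
    show "x \<in> fine_slopes G P"
      unfolding fine_slopes_def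
    proof (intro CollectI allI impI)
      fix d :: real assume "d > 0"
      then obtain n where n: "1 / real (Suc n) < d" using nat_approx_posE by blast
      have "x \<in> W n" using x by blast
      then obtain a b where "a < x" "x < b" "b - a < 1 / real (Suc n)" "P (G b - G a) (b - a)"
        unfolding W_def by auto
      then show "\<exists>a b. a < x \<and> x < b \<and> b - a < d \<and> P (G b - G a) (b - a)"
        using n by (intro exI[of _ a] exI[of _ b]) auto
    qed
  qed
  moreover have "open (W n)" for n unfolding W_def by auto
  ultimately show ?thesis by auto
qed

text \<open>Let mu be the Stieltjes measure of \<open>G\<close>. For a bounded piece E of the set,
  two nested Vitali coverings inside an open V of measure below |E| + e give q |E| \<le> q |U2|
  \<le> mu(U2) \<le> mu(U1) \<le> p |U1| \<le> p (|E| + e). As e tends to 0 this forces |E| = 0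
  because p < q.\<close>

lemma negligible_slopes_gap:
  fixes G :: "real \<Rightarrow> real"
  assumes mono: "\<And>x y. x \<le> y \<Longrightarrow> G x \<le> G y" and cont: "continuous_on UNIV G"
    and pq: "0 \<le> p" "p < q"
  shows "negligible (fine_slopes G (\<lambda>u v. u \<le> p * v) \<inter> fine_slopes G (\<lambda>u v. q * v \<le> u))"
    (is "negligible (?B \<inter> ?A)")
proof -
  let ?\<mu> = "interval_measure G"
  have "negligible (?B \<inter> ?A \<inter> cbox l r)" for l r :: real
  proof -
    define E where "E = ?B \<inter> ?A \<inter> cbox l r"
    have EM: "E \<in> lmeasurable"
      unfolding E_def by (rule bounded_set_imp_lmeasurable) (auto intro: bounded_subset[OF bounded_cbox])
    have "q * measure lebesgue E \<le> p * (measure lebesgue E + e)" if e: "e > 0" for e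
    proof -
      obtain V where V: "open V" "E \<subseteq> V" "V \<in> lmeasurable"
          "measure lebesgue V < measure lebesgue E + e"
      proof -
        obtain V where V: "open V" "E \<subseteq> V" "V - E \<in> lmeasurable" "emeasure lebesgue (V - E) < ennreal e"
          using sets_lebesgue_outer_open[OF fmeasurableD[OF EM] e] by metis
        have Veq: "V = E \<union> (V - E)" using V by blast
        have "measure lebesgue (V - E) < e"
          using V(3,4) e by (simp add: emeasure_eq_measure2 ennreal_less_iff)
        moreover have "V \<in> lmeasurable"
          using EM V(3) Veq fmeasurable.Un by metis
        moreover have "measure lebesgue V \<le> measure lebesgue E + measure lebesgue (V - E)"
          using Veq measure_Un_le[of E lebesgue "V - E"] EM V(3) by (metis fmeasurableD)
        ultimately show thesis using V that[of V] by auto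
      qed
      have emIoo: "emeasure ?\<mu> {a<..<b} = ennreal (G b - G a)" if "a < b" for a b
        using emeasure_interval_measure_Ioo[OF _ mono cont, of a b] that by simp
      obtain U1 where U1: "open U1" "U1 \<subseteq> V" "negligible (E - U1)"
        "emeasure ?\<mu> U1 \<le> emeasure (scale_measure (ennreal p) lborel) U1"
      proof (rule vitali_compare[of ?\<mu> "scale_measure (ennreal p) lborel" V E])
        fix x d :: real assume "x \<in> E" "0 < d"
        then obtain a b where ab: "a < x" "x < b" "b - a < d" "G b - G a \<le> p * (b - a)"
          unfolding E_def fine_slopes_def by blast
        then show "\<exists>a b. a < x \<and> x < b \<and> b - a < d \<and>
          emeasure ?\<mu> {a<..<b} \<le> emeasure (scale_measure (ennreal p) lborel) {a<..<b}"
          using emIoo[of a b] pq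
          by (intro exI[of _ a] exI[of _ b]) (auto simp: ennreal_mult[symmetric] intro!: ennreal_leI)
      qed (use V in auto)
      \<comment> \<open>The second covering is carried out inside \<open>U1\<close>, so that the two
        comparisons chain through monotonicity of the Stieltjes measure.\<close>
      obtain U2 where U2: "open U2" "U2 \<subseteq> U1" "negligible (E \<inter> U1 - U2)"
        "emeasure (scale_measure (ennreal q) lborel) U2 \<le> emeasure ?\<mu> U2"
      proof (rule vitali_compare[of "scale_measure (ennreal q) lborel" ?\<mu> U1 "E \<inter> U1"])
        fix x d :: real assume "x \<in> E \<inter> U1" "0 < d"
        then obtain a b where ab: "a < x" "x < b" "b - a < d" "q * (b - a) \<le> G b - G a"
          unfolding E_def fine_slopes_def by blast
        then show "\<exists>a b. a < x \<and> x < b \<and> b - a < d \<and>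
          emeasure (scale_measure (ennreal q) lborel) {a<..<b} \<le> emeasure ?\<mu> {a<..<b}"
          using emIoo[of a b] pq
          by (intro exI[of _ a] exI[of _ b]) (auto simp: ennreal_mult[symmetric] intro!: ennreal_leI)
      qed (use U1 in auto)
      have fin: "emeasure lborel V < \<infinity>"
        using V(1,3) fmeasurableD2[of V lebesgue] by (simp add: top.not_eq_extremum)
      have "emeasure lborel U2 \<le> emeasure lborel V"
        using U1 U2 V(1) by (intro emeasure_mono) auto
      then have fin2: "U2 \<in> lmeasurable" "U1 \<in> lmeasurable"
        using U1 U2 V(1,3) fmeasurableI2[OF V(3)] by auto
      have "ennreal q * emeasure lborel U2 \<le> emeasure ?\<mu> U2"
        using U2(4) U2(1) by simp
      also have "\<dots> \<le> emeasure ?\<mu> U1"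
        using U1 U2 by (intro emeasure_mono) auto
      also have "\<dots> \<le> ennreal p * emeasure lborel U1"
        using U1(4) U1(1) by simp
      finally have "ennreal q * emeasure lborel U2 \<le> ennreal p * emeasure lborel U1" .
      moreover have "emeasure lborel U2 = ennreal (measure lebesgue U2)"
          "emeasure lborel U1 = ennreal (measure lebesgue U1)"
        using fin2 U1(1) U2(1) emeasure_eq_measure2[of U2 lebesgue] emeasure_eq_measure2[of U1 lebesgue]
        by auto
      ultimately have le: "q * measure lebesgue U2 \<le> p * measure lebesgue U1"
        using pq by (simp add: ennreal_mult[symmetric])
      have "measure lebesgue E \<le> measure lebesgue (U2 \<union> ((E - U1) \<union> (E \<inter> U1 - U2)))"
        using fin2 U1(3) U2(3) EM
        by (intro measure_mono_fmeasurable) (auto simp: negligible_imp_measurable fmeasurable.Un)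
      also have "\<dots> = measure lebesgue U2"
        using U1(3) U2(3) fin2 by (intro measure_Un_null_set) (auto simp: negligible_iff_null_sets null_sets.Un)
      finally have "q * measure lebesgue E \<le> q * measure lebesgue U2"
        using pq by (intro mult_left_mono) auto
      also have "\<dots> \<le> p * measure lebesgue U1" by (rule le)
      also have "\<dots> \<le> p * measure lebesgue V"
        using pq U1(2) V fin2 by (intro mult_left_mono measure_mono_fmeasurable) auto
      also have "\<dots> \<le> p * (measure lebesgue E + e)"
        using pq V by (intro mult_left_mono) auto
      finally show ?thesis .
    qed note * = this
    have "(\<lambda>e. p * (measure lebesgue E + e)) \<midarrow>0\<rightarrow> p * (measure lebesgue E + 0)"
      by (intro tendsto_intros)
    then have "((\<lambda>e. p * (measure lebesgue E + e)) \<longlongrightarrow> p * measure lebesgue E) (at_right 0)"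
      using filterlim_at_split by auto
    then have "q * measure lebesgue E \<le> p * measure lebesgue E"
      by (rule tendsto_lowerbound) (auto simp: eventually_at_right_less eventually_at_topological * 
            intro!: eventually_at_rightI[of 0 1])
    then have "(q - p) * measure lebesgue E \<le> 0" by (simp add: algebra_simps)
    then have "measure lebesgue E \<le> 0" using pq by (simp add: mult_le_0_iff)
    then have "measure lebesgue E = 0" by (simp add: antisym)
    then show ?thesis using EM unfolding E_def[symmetric] by (simp add: negligible_iff_measure)
  qed
  then show ?thesis
    by (subst negligible_on_intervals) blast
qed

text \<open>The hypothesis concerns only intervals with x strictly inside. Letting one endpoint tend
  to x, with \<open>G\<close> continuous, turns it into the estimate for difference quotients based
  at x.\<close>

lemma has_derivative_from_slopes:
  fixes G :: "real \<Rightarrow> real"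
  assumes cont: "continuous_on UNIV G"
    and slopes: "\<And>e. e > 0 \<Longrightarrow> \<exists>d>0. \<forall>a b. a < x \<longrightarrow> x < b \<longrightarrow> b - a < d \<longrightarrow>
      \<bar>G b - G a - l * (b - a)\<bar> \<le> e * (b - a)"
  shows "(G has_derivative (\<lambda>h. l * h)) (at x)"
  unfolding has_derivative_at_alt
proof (intro conjI allI impI)
  show "bounded_linear ((*) l)" by (rule bounded_linear_mult_right)
  fix e :: real assume "e > 0"
  then obtain d where d: "d > 0" "\<And>a b. a < x \<Longrightarrow> x < b \<Longrightarrow> b - a < d \<Longrightarrow>
      \<bar>G b - G a - l * (b - a)\<bar> \<le> e * (b - a)"
    using slopes by metis
  have lim: "(\<lambda>a. G a) \<midarrow>x\<rightarrow> G x"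
    using cont by (simp add: continuous_on_eq_continuous_at isCont_def)
  have "norm (G y - G x - l * (y - x)) \<le> e * norm (y - x)" if y: "norm (y - x) < d" for y
  proof (cases y x rule: linorder_cases)
    case greater
    have "((\<lambda>a. e * (y - a) - \<bar>G y - G a - l * (y - a)\<bar>) \<longlongrightarrow> e * (y - x) - \<bar>G y - G x - l * (y - x)\<bar>) (at_left x)"
      using lim by (intro tendsto_intros) (auto simp: filterlim_at_split)
    moreover have "eventually (\<lambda>a. 0 \<le> e * (y - a) - \<bar>G y - G a - l * (y - a)\<bar>) (at_left x)"
      using y greater d(2)[of _ y] by (intro eventually_at_leftI[of "y - d"]) auto
    ultimately have "0 \<le> e * (y - x) - \<bar>G y - G x - l * (y - x)\<bar>"
      by (intro tendsto_lowerbound) auto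
    then show ?thesis using greater by simp
  next
    case less
    have "((\<lambda>b. e * (b - y) - \<bar>G b - G y - l * (b - y)\<bar>) \<longlongrightarrow> e * (x - y) - \<bar>G x - G y - l * (x - y)\<bar>) (at_right x)"
      using lim by (intro tendsto_intros) (auto simp: filterlim_at_split)
    moreover have "eventually (\<lambda>b. 0 \<le> e * (b - y) - \<bar>G b - G y - l * (b - y)\<bar>) (at_right x)"
      using y less d(2)[of y] by (intro eventually_at_rightI[of _ "y + d"]) auto
    ultimately have "0 \<le> e * (x - y) - \<bar>G x - G y - l * (x - y)\<bar>"
      by (intro tendsto_lowerbound) auto
    moreover have "\<bar>G x - G y - l * (x - y)\<bar> = \<bar>G y - G x - l * (y - x)\<bar>"
      by (subst abs_minus_commute) (simp add: algebra_simps)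
    ultimately show ?thesis using less by simp
  qed simp
  then show "\<exists>d>0. \<forall>y. norm (y - x) < d \<longrightarrow> norm (G y - G x - l * (y - x)) \<le> e * norm (y - x)"
    using d(1) by blast
qed

text \<open>If upper and lower derivates differ at x, two rationals p < q fit between them, so x
  lies in one of countably many negligible gap sets. The Lipschitz bound keeps the derivates finite,
  and monotonicity keeps them nonnegative.\<close>

lemma mono_lipschitz_differentiable_negligible:
  fixes G :: "real \<Rightarrow> real"
  assumes mono: "\<And>x y. x \<le> y \<Longrightarrow> G x \<le> G y"
    and lip: "\<And>x y. \<bar>G x - G y\<bar> \<le> L * \<bar>x - y\<bar>"
  shows "negligible {x. \<not> G differentiable (at x)}"
proof -
  have "L \<ge> 0" using order_trans[OF abs_ge_zero lip[of 1 0]] by simp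
  then have cont: "continuous_on UNIV G"
    using lip by (intro lipschitz_on_continuous_on[of L]) (auto simp: lipschitz_on_def dist_real_def)
  define N where "N = (\<Union>(p, q)\<in>{(p, q). p \<in> \<rat> \<and> q \<in> \<rat> \<and> 0 \<le> p \<and> p < q}.
    fine_slopes G (\<lambda>u v. u \<le> p * v) \<inter> fine_slopes G (\<lambda>u v. q * v \<le> u))"
  have "countable {(p, q). p \<in> \<rat> \<and> q \<in> \<rat> \<and> 0 \<le> p \<and> p < (q::real)}"
    by (rule countable_subset[of _ "\<rat> \<times> \<rat>"]) (auto intro: countable_rat)
  then have "negligible N"
    unfolding N_def using negligible_slopes_gap[OF mono cont]
    by (intro negligible_countable_Union) auto
  moreover have "G differentiable (at x)" if x: "x \<notin> N" for x
  proof -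
    define S where "S = {q. x \<in> fine_slopes G (\<lambda>u v. q * v \<le> u)}"
    have S0: "0 \<in> S"
    proof -
      have "\<exists>a b. a < x \<and> x < b \<and> b - a < d \<and> 0 * (b - a) \<le> G b - G a" if "d > 0" for d
        using that mono[of "x - d/3" "x + d/3"] by (intro exI[of _ "x - d/3"] exI[of _ "x + d/3"]) auto
      then show ?thesis by (auto simp: S_def fine_slopes_def)
    qed
    have SL: "q \<le> L" if qS: "q \<in> S" for q
    proof -
      have "(0::real) < 1" by simp
      then obtain a b where "a < x" "x < b" "q * (b - a) \<le> G b - G a"
        using qS unfolding S_def fine_slopes_def by blast
      moreover have "G b - G a \<le> L * (b - a)" using lip[of b a] \<open>a < x\<close> \<open>x < b\<close> by simp
      ultimately have "q * (b - a) \<le> L * (b - a)" by linarith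
      then show ?thesis using \<open>a < x\<close> \<open>x < b\<close> by (intro mult_right_le_imp_le[of q "b - a" L]) auto
    qed
    \<comment> \<open>The upper derivate at x. Outside \<open>N\<close> it is shown to bound the
      slopes of short intervals from below as well, up to any e > 0.\<close>
    define l where "l = Sup S"
    have bdd: "bdd_above S" using SL by (auto simp: bdd_above_def)
    have l0: "0 \<le> l" unfolding l_def by (rule cSup_upper[OF S0 bdd])
    have up: "\<exists>d>0. \<forall>a b. a < x \<longrightarrow> x < b \<longrightarrow> b - a < d \<longrightarrow> G b - G a \<le> (l + e) * (b - a)"
      if "e > 0" for e
    proof -
      have "l + e \<notin> S" using cSup_upper[OF _ bdd, of "l + e"] that unfolding l_def by auto
      then show ?thesis unfolding S_def fine_slopes_def by (auto simp: not_le) (meson less_imp_le not_le)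
    qed
    have lo: "\<exists>d>0. \<forall>a b. a < x \<longrightarrow> x < b \<longrightarrow> b - a < d \<longrightarrow> (l - e) * (b - a) \<le> G b - G a"
      if e: "e > 0" for e
    \<comment> \<open>The exceptional set \<open>N\<close> uses only p \<ge> 0; a negative lower
      bound for the slopes comes from monotonicity instead.\<close>
    proof (cases "l - e < 0")
      case True
      have "(l - e) * (b - a) \<le> G b - G a" if "a < x" "x < b" for a b
        using True mono[of a b] that mult_nonpos_nonneg[of "l - e" "b - a"] by linarith
      then show ?thesis by (intro exI[of _ 1]) auto
    next
      case False
      \<comment> \<open>Rationals l - e < p < q < l: since q is below the supremum, x has
        arbitrarily short intervals of slope at least q. As x avoids \<open>N\<close>, slopes at
        most p then cannot occur on arbitrarily short intervals.\<close>
      obtain p where p: "p \<in> \<rat>" "l - e < p" "p < l" using e Rats_dense_in_real[of "l - e" l] by auto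
      obtain q where q: "q \<in> \<rat>" "p < q" "q < l" using p Rats_dense_in_real[of p l] by auto
      obtain s where s: "s \<in> S" "q < s"
        using q less_cSup_iff[OF _ bdd, of q] S0 unfolding l_def by auto
      have "x \<in> fine_slopes G (\<lambda>u v. q * v \<le> u)"
        unfolding fine_slopes_def
      proof (intro CollectI allI impI)
        fix d :: real assume "d > 0"
        then obtain a b where "a < x" "x < b" "b - a < d" "s * (b - a) \<le> G b - G a"
          using s(1) unfolding S_def fine_slopes_def by blast
        moreover from this have "q * (b - a) \<le> s * (b - a)" using s(2) by (intro mult_right_mono) auto
        ultimately show "\<exists>a b. a < x \<and> x < b \<and> b - a < d \<and> q * (b - a) \<le> G b - G a"
          by (meson order_trans)
      qed
      then have "x \<notin> fine_slopes G (\<lambda>u v. u \<le> p * v)"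
        using x p q False unfolding N_def by auto
      then obtain d where d: "d > 0" "\<And>a b. a < x \<Longrightarrow> x < b \<Longrightarrow> b - a < d \<Longrightarrow> p * (b - a) < G b - G a"
        unfolding fine_slopes_def by (auto simp: not_le)
      have "(l - e) * (b - a) \<le> G b - G a" if "a < x" "x < b" "b - a < d" for a b
        using d(2)[OF that] p(2) that mult_right_mono[of "l - e" p "b - a"] by linarith
      then show ?thesis using d(1) by blast
    qed
    have "(G has_derivative (\<lambda>h. l * h)) (at x)"
    proof (rule has_derivative_from_slopes[OF cont])
      fix e :: real assume "e > 0"
      then obtain d1 d2 where "d1 > 0" "d2 > 0"
        and 1: "\<And>a b. a < x \<Longrightarrow> x < b \<Longrightarrow> b - a < d1 \<Longrightarrow> G b - G a \<le> (l + e) * (b - a)"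
        and 2: "\<And>a b. a < x \<Longrightarrow> x < b \<Longrightarrow> b - a < d2 \<Longrightarrow> (l - e) * (b - a) \<le> G b - G a"
        using up lo by metis
      then show "\<exists>d>0. \<forall>a b. a < x \<longrightarrow> x < b \<longrightarrow> b - a < d \<longrightarrow> \<bar>G b - G a - l * (b - a)\<bar> \<le> e * (b - a)"
        by (intro exI[of _ "min d1 d2"]) (fastforce simp: abs_le_iff algebra_simps)
    qed
    then show ?thesis by (auto simp: differentiable_def)
  qed
  ultimately show ?thesis
    by (metis (mono_tags, lifting) mem_Collect_eq negligible_subset subsetI)
qed

text \<open>Adding L x makes the function monotone, keeps it Lipschitz with constant 2 L, and does
  not affect differentiability.\<close>

lemma lipschitz_differentiable_negligible:
  fixes G :: "real \<Rightarrow> real"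
  assumes lip: "\<And>x y. \<bar>G x - G y\<bar> \<le> L * \<bar>x - y\<bar>"
  shows "negligible {x. \<not> G differentiable (at x)}"
proof -
  have L0: "L \<ge> 0" using order_trans[OF abs_ge_zero lip[of 1 0]] by simp
  define H where "H = (\<lambda>x. G x + L * x)"
  have "negligible {x. \<not> H differentiable (at x)}"
  proof (rule mono_lipschitz_differentiable_negligible)
    show "H x \<le> H y" if "x \<le> y" for x y
      using lip[of x y] that by (simp add: H_def abs_le_iff algebra_simps)
    show "\<bar>H x - H y\<bar> \<le> (2 * L) * \<bar>x - y\<bar>" for x y
    proof -
      have "\<bar>H x - H y\<bar> = \<bar>(G x - G y) + L * (x - y)\<bar>" by (simp add: H_def algebra_simps)
      also have "\<dots> \<le> \<bar>G x - G y\<bar> + \<bar>L * (x - y)\<bar>" by (rule abs_triangle_ineq)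
      also have "\<dots> \<le> (2 * L) * \<bar>x - y\<bar>" using lip[of x y] L0 by (simp add: abs_mult)
      finally show ?thesis .
    qed
  qed
  moreover have "G differentiable (at x)" if "H differentiable (at x)" for x
  proof -
    have "(\<lambda>x. H x - L * x) differentiable (at x)" using that by (intro derivative_intros) auto
    then show ?thesis by (simp add: H_def)
  qed
  then have "{x. \<not> G differentiable (at x)} \<subseteq> {x. \<not> H differentiable (at x)}" by blast
  ultimately show ?thesis by (rule negligible_subset)
qed

lemma lipschitz_complex_differentiable_negligible:
  fixes F :: "real \<Rightarrow> complex"
  assumes lip: "\<And>x y. norm (F x - F y) \<le> L * \<bar>x - y\<bar>"
  shows "negligible {x. \<not> F differentiable (at x)}"
proof -
  have "negligible {x. \<not> (\<lambda>t. Re (F t)) differentiable (at x)}"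
    by (rule lipschitz_differentiable_negligible[of _ L])
      (metis abs_Re_le_cmod lip minus_complex.sel(1) order_trans)
  moreover have "negligible {x. \<not> (\<lambda>t. Im (F t)) differentiable (at x)}"
    by (rule lipschitz_differentiable_negligible[of _ L])
      (metis abs_Im_le_cmod lip minus_complex.sel(2) order_trans)
  ultimately have "negligible ({x. \<not> (\<lambda>t. Re (F t)) differentiable (at x)} \<union> {x. \<not> (\<lambda>t. Im (F t)) differentiable (at x)})"
    by (rule negligible_Un)
  moreover have "F differentiable (at x)"
    if "(\<lambda>t. Re (F t)) differentiable (at x)" "(\<lambda>t. Im (F t)) differentiable (at x)" for x
    using that by (subst differentiable_componentwise_within) (auto simp: Basis_complex_def inner_complex_def)
  then have "{x. \<not> F differentiable (at x)} \<subseteq>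
      {x. \<not> (\<lambda>t. Re (F t)) differentiable (at x)} \<union> {x. \<not> (\<lambda>t. Im (F t)) differentiable (at x)}"
    by blast
  ultimately show ?thesis by (rule negligible_subset)
qed

section \<open>The Poisson formula\<close>

definition poisson_kernel :: "real \<Rightarrow> real" where
  "poisson_kernel s = 1 / (pi * (1 + s\<^sup>2))"

lemma one_plus_square_pos: "0 < 1 + (s::real)\<^sup>2"
  by (simp add: add_pos_nonneg)

lemma poisson_kernel_nonneg: "0 \<le> poisson_kernel s"
  by (simp add: poisson_kernel_def)

lemma continuous_poisson_kernel: "continuous_on A poisson_kernel"
  unfolding poisson_kernel_def using one_plus_square_pos
  by (intro continuous_intros) (auto simp: less_imp_neq[symmetric])

lemma poisson_kernel_measurable [measurable]: "poisson_kernel \<in> borel_measurable borel"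
  by (rule borel_measurable_continuous_onI[OF continuous_poisson_kernel])

lemma integrable_poisson_kernel: "integrable lborel poisson_kernel"
  and integral_poisson_kernel: "(LINT s|lborel. poisson_kernel s) = 1"
proof -
  have eq: "poisson_kernel s = (1 / pi) * inverse (1 + s\<^sup>2)" for s
    by (simp add: poisson_kernel_def field_simps)
  have 1: "integrable lborel (\<lambda>s::real. inverse (1 + s\<^sup>2))"
    using integrable_inverse_1_plus_square by (simp add: set_integrable_def)
  then show "integrable lborel poisson_kernel" unfolding eq[abs_def] by (intro integrable_mult_right) auto
  have "(LINT s|lborel. inverse (1 + s\<^sup>2)) = pi"
    using LBINT_inverse_1_plus_square
    by (simp add: interval_lebesgue_integral_def set_lebesgue_integral_def)
  then show "(LINT s|lborel. poisson_kernel s) = 1" unfolding eq by simp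
qed

text \<open>
  Cauchy's formula on large rectangles for \<open>2 h(z) / (z + 1)\<close>: the extra factor makes the kernel
  decay quadratically and equals 1 at the point 1.
\<close>
lemma poisson_at_one:
  fixes h :: "complex \<Rightarrow> complex"
  assumes d: "d > 0" and hol: "h holomorphic_on {z. Re z > - d}"
    and bd: "\<And>z. Re z > - d \<Longrightarrow> norm (h z) \<le> M"
  shows "(LINT s|lborel. complex_of_real (poisson_kernel s) * h (Complex 0 s)) = h 1"
proof -
  define f where "f = (\<lambda>z. 2 * h z / (z + 1))"
  define g where "g = (\<lambda>z. f z / (z - 1))"
  \<comment> \<open>Capping at 1 keeps the pole -1 of the extra factor outside
    \<open>S\<close>.\<close>
  define d' where "d' = min d 1"
  define S where "S = {z. Re z > - d'}"
  define q where "q = (\<lambda>s. complex_of_real (poisson_kernel s) * h (Complex 0 s))"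
  have M: "0 \<le> M" using bd[of 0] d by (smt (verit) norm_ge_zero zero_complex.sel(1))
  have S: "open S" "convex S" unfolding S_def
    by (auto simp: open_halfspace_Re_gt convex_halfspace_Re_gt)
  have Sne: "z + 1 \<noteq> 0" if "z \<in> S" for z
    using that by (auto simp: S_def d'_def complex_eq_iff)
  have hS: "h holomorphic_on S"
    using hol by (rule holomorphic_on_subset) (auto simp: S_def d'_def)
  have fhol: "f holomorphic_on S"
    unfolding f_def using Sne by (intro holomorphic_intros hS) auto
  have gcont: "continuous_on (S - {1}) g"
    unfolding g_def using Sne
    by (intro continuous_intros holomorphic_on_imp_continuous_on[OF holomorphic_on_subset[OF fhol]]) auto
  have hcont: "continuous_on UNIV (\<lambda>s. h (Complex 0 s))"
    using d by (intro continuous_on_compose2[OF holomorphic_on_imp_continuous_on[OF hol]])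
      (auto simp: Complex_eq intro!: continuous_intros)
  have qcont: "continuous_on A q" for A
    unfolding q_def by (intro continuous_intros continuous_poisson_kernel continuous_on_subset[OF hcont]) auto
  have [measurable]: "q \<in> borel_measurable borel"
    by (rule borel_measurable_continuous_onI[OF qcont])
  have q_le: "norm (q s) \<le> M * poisson_kernel s" for s
    using bd[of "Complex 0 s"] d poisson_kernel_nonneg[of s]
    by (auto simp: q_def norm_mult mult.commute[of M] intro!: mult_left_mono)
  \<comment> \<open>On the imaginary axis (z + 1)(z - 1) = -(1 + s^2), which is how the Poisson
    kernel arises from the Cauchy kernel.\<close>
  have gq: "g (Complex 0 s) = - (2 * pi) * q s" for s
  proof -
    have "(Complex 0 s + 1) * (Complex 0 s - 1) = - complex_of_real (1 + s\<^sup>2)"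
      by (simp add: complex_eq_iff power2_eq_square)
    then have "g (Complex 0 s) = 2 * h (Complex 0 s) / (- complex_of_real (1 + s\<^sup>2))"
      unfolding g_def f_def by (simp add: divide_divide_eq_left)
    also have "\<dots> = - (2 * pi) * q s"
      unfolding q_def poisson_kernel_def using one_plus_square_pos[of s]
      by (simp add: divide_simps del: of_real_add) 
    finally show ?thesis .
  qed
  \<comment> \<open>Starting at 2 puts the point 1 inside every rectangle and keeps R^2 - 1
    positive.\<close>
  define R where "R = (\<lambda>n. real n + 2)"
  have main: "norm (h 1 - integral {- R n..R n} q) \<le> 8 * M * R n / ((R n)\<^sup>2 - 1)" for n
  proof -
    let ?R = "R n"
    have R: "?R \<ge> 2" by (simp add: R_def)
    define a1 a2 a3 a4 where "a1 = Complex 0 (- ?R)" "a2 = Complex ?R (- ?R)"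
      "a3 = Complex ?R ?R" "a4 = Complex 0 ?R"
    note a = this
    have one: "1 \<in> box a1 a3" using R by (auto simp: a in_box_complex_iff)
    have sub: "path_image (rectpath a1 a3) \<subseteq> S - {1}"
    proof -
      have "path_image (rectpath a1 a3) = cbox a1 a3 - box a1 a3"
        using R by (intro path_image_rectpath_cbox_minus_box) (auto simp: a)
      moreover have "z \<in> S" if "z \<in> cbox a1 a3" for z
      proof -
        have "0 \<le> Re z" using that by (simp add: a in_cbox_complex_iff)
        then show ?thesis using d by (simp add: S_def d'_def)
      qed
      ultimately show ?thesis using one by blast
    qed
    have "(g has_contour_integral (2 * pi * \<i> * winding_number (rectpath a1 a3) 1 * f 1)) (rectpath a1 a3)"
      unfolding g_def
      using S one sub d by (intro Cauchy_integral_formula_convex_simple[OF S(2) fhol])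
        (auto simp: interior_open S_def d'_def)
    then have ci: "(g has_contour_integral (2 * pi * \<i> * h 1)) (rectpath a1 a3)"
      using winding_number_rectpath[OF one] by (simp add: f_def)
    have rp: "rectpath a1 a3 = linepath a1 a2 +++ linepath a2 a3 +++ linepath a3 a4 +++ linepath a4 a1"
      by (simp add: rectpath_def a Let_def)
    have segs: "closed_segment a1 a2 \<subseteq> S - {1}" "closed_segment a2 a3 \<subseteq> S - {1}"
        "closed_segment a3 a4 \<subseteq> S - {1}" "closed_segment a4 a1 \<subseteq> S - {1}"
      using sub by (auto simp: rp path_image_join)
    have int: "g contour_integrable_on linepath a1 a2" "g contour_integrable_on linepath a2 a3"
        "g contour_integrable_on linepath a3 a4" "g contour_integrable_on linepath a4 a1"
      using segs by (auto intro!: contour_integrable_continuous_linepath continuous_on_subset[OF gcont])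
    have sum: "2 * pi * \<i> * h 1 = contour_integral (linepath a1 a2) g + (contour_integral (linepath a2 a3) g
       + (contour_integral (linepath a3 a4) g + contour_integral (linepath a4 a1) g))"
      using contour_integral_unique[OF ci] int unfolding rp by simp
    \<comment> \<open>The side on the axis is traversed downwards. Reversing it cancels the minus
      sign in \<open>gq\<close>, so this side contributes the truncated Poisson integral.\<close>
    have "contour_integral (linepath a4 a1) g = - contour_integral (linepath a1 a4) g"
      using contour_integral_reverse_linepath[of a1 a4 g] segs(4) gcont
      by (metis closed_segment_commute continuous_on_subset minus_minus)
    also have "contour_integral (linepath a1 a4) g = \<i> * integral {- ?R..?R} (\<lambda>s. g (Complex 0 s))"
      using R by (intro contour_integral_linepath_same_Re) (auto simp: a)
    also have "\<dots> = - (2 * pi * \<i> * integral {- ?R..?R} q)"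
      unfolding gq by simp
    finally have last: "contour_integral (linepath a4 a1) g = 2 * pi * \<i> * integral {- ?R..?R} q" by simp
    \<comment> \<open>On the three other sides |z^2 - 1| \<ge> R^2 - 1, so \<open>B\<close> bounds g
      there. Their total length is 4 R, which gives the error 4 B R = 8 M R / (R^2 - 1) once the
      factor 2 pi on the left is weakened to 1.\<close>
    define B where "B = 2 * M / (?R\<^sup>2 - 1)"
    have R1: "?R\<^sup>2 - 1 > 0" using R by (simp add: power2_eq_square) (smt (verit) mult_less_cancel_left2)
    have B: "0 \<le> B" using R1 M by (simp add: B_def)
    have gB: "norm (g z) \<le> B" if z: "z \<in> S" "norm z \<ge> ?R" for z
    proof -
      have "?R\<^sup>2 \<le> (norm z)\<^sup>2" using z(2) R by (intro power_mono) auto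
      moreover have "norm (z\<^sup>2 - 1) \<ge> (norm z)\<^sup>2 - 1"
        using norm_triangle_ineq2[of "z\<^sup>2" 1] by (simp add: norm_power)
      ultimately have n1: "norm (z\<^sup>2 - 1) \<ge> ?R\<^sup>2 - 1" by linarith
      have "g z = 2 * h z / (z\<^sup>2 - 1)" by (simp add: g_def f_def power2_eq_square algebra_simps)
      then have "norm (g z) = 2 * norm (h z) / norm (z\<^sup>2 - 1)" by (simp add: norm_divide norm_mult)
      also have "\<dots> \<le> B" unfolding B_def
        using n1 R1 bd[of z] z(1) by (intro frac_le) (auto simp: S_def d'_def M)
      finally show ?thesis .
    qed
    have nb: "norm z \<ge> ?R" if "\<bar>Re z\<bar> \<ge> ?R \<or> \<bar>Im z\<bar> \<ge> ?R" for z
      using that abs_Re_le_cmod[of z] abs_Im_le_cmod[of z] by linarith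
    have 1: "norm (contour_integral (linepath a1 a2) g) \<le> B * ?R"
    proof -
      have "norm (contour_integral (linepath a1 a2) g) \<le> B * norm (a2 - a1)"
        using segs(1) R by (intro contour_integral_bound_linepath int B gB nb)
          (auto simp: a closed_segment_same_Im)
      moreover have "norm (a2 - a1) = ?R" using R by (simp add: a cmod_def)
      ultimately show ?thesis by simp
    qed
    have 2: "norm (contour_integral (linepath a2 a3) g) \<le> B * (2 * ?R)"
    proof -
      have "norm (contour_integral (linepath a2 a3) g) \<le> B * norm (a3 - a2)"
        using segs(2) R by (intro contour_integral_bound_linepath int B gB nb)
          (auto simp: a closed_segment_same_Re)
      moreover have "a3 - a2 = of_real (2 * ?R) * \<i>" by (simp add: a complex_eq_iff)
      then have "norm (a3 - a2) = 2 * ?R" using R by (simp add: norm_mult)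
      ultimately show ?thesis by simp
    qed
    have 3: "norm (contour_integral (linepath a3 a4) g) \<le> B * ?R"
    proof -
      have "norm (contour_integral (linepath a3 a4) g) \<le> B * norm (a4 - a3)"
        using segs(3) R by (intro contour_integral_bound_linepath int B gB nb)
          (auto simp: a closed_segment_same_Im)
      moreover have "norm (a4 - a3) = ?R" using R by (simp add: a cmod_def)
      ultimately show ?thesis by simp
    qed
    have "2 * pi * \<i> * (h 1 - integral {- ?R..?R} q) = contour_integral (linepath a1 a2) g +
       contour_integral (linepath a2 a3) g + contour_integral (linepath a3 a4) g"
      using sum last by (simp add: algebra_simps)
    then have "2 * pi * norm (h 1 - integral {- ?R..?R} q) = norm (contour_integral (linepath a1 a2) g +
       contour_integral (linepath a2 a3) g + contour_integral (linepath a3 a4) g)"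
      using norm_mult[of "2 * pi * \<i>" "h 1 - integral {- ?R..?R} q"] by (simp add: norm_mult)
    also have "\<dots> \<le> B * ?R + B * (2 * ?R) + B * ?R"
      using 1 2 3 by (meson add_mono norm_triangle_le)
    finally have "2 * pi * norm (h 1 - integral {- ?R..?R} q) \<le> 4 * B * ?R" by simp
    moreover have "norm (h 1 - integral {- ?R..?R} q) \<le> 2 * pi * norm (h 1 - integral {- ?R..?R} q)"
      using pi_gt3 mult_right_mono[of 1 "2 * pi" "norm (h 1 - integral {- ?R..?R} q)"] by simp
    ultimately show ?thesis by (simp add: B_def)
  qed
  have Rlim: "filterlim R at_top sequentially"
    unfolding R_def by real_asymp
  have "(\<lambda>n. 8 * M * R n / ((R n)\<^sup>2 - 1)) \<longlonglongrightarrow> 0"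
    unfolding R_def by real_asymp
  then have "(\<lambda>n. h 1 - integral {- R n..R n} q) \<longlonglongrightarrow> 0"
    by (rule Lim_null_comparison[rotated]) (simp add: main)
  then have lim1: "(\<lambda>n. integral {- R n..R n} q) \<longlonglongrightarrow> h 1"
    using tendsto_diff[OF tendsto_const[of "h 1"]] by fastforce
  have ieq: "integral {- R n..R n} q = (LINT s|lborel. indicator {- R n..R n} s *\<^sub>R q s)" for n
    using set_borel_integral_eq_integral(2)[of "{- R n..R n}" q] borel_integrable_atLeastAtMost'[OF qcont]
    by (simp add: set_lebesgue_integral_def)
  have "(\<lambda>n. LINT s|lborel. indicator {- R n..R n} s *\<^sub>R q s) \<longlonglongrightarrow> (LINT s|lborel. q s)"
  proof (rule integral_dominated_convergence[where w="\<lambda>s. M * poisson_kernel s"])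
    show "integrable lborel (\<lambda>s. M * poisson_kernel s)"
      by (intro integrable_mult_right integrable_poisson_kernel)
    show "AE s in lborel. (\<lambda>n. indicator {- R n..R n} s *\<^sub>R q s) \<longlonglongrightarrow> q s"
    proof (intro AE_I2)
      fix s :: real
      have "eventually (\<lambda>n. \<bar>s\<bar> \<le> R n) sequentially"
        using Rlim by (auto simp: filterlim_at_top)
      then have "eventually (\<lambda>n. indicator {- R n..R n} s *\<^sub>R q s = q s) sequentially"
        by eventually_elim (auto simp: indicator_def)
      then show "(\<lambda>n. indicator {- R n..R n} s *\<^sub>R q s) \<longlonglongrightarrow> q s"
        by (rule tendsto_eventually)
    qed
    show "AE s in lborel. norm (indicator {- R n..R n} s *\<^sub>R q s) \<le> M * poisson_kernel s" for n
      using q_le M poisson_kernel_nonneg by (auto simp: indicator_def)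
  qed auto
  from LIMSEQ_unique[OF this lim1[unfolded ieq]] show ?thesis by (simp add: q_def)
qed

section \<open>Radial limits\<close>

text \<open>Minus the derivative of the Poisson kernel.\<close>
definition dpoisson :: "real \<Rightarrow> real" where
  "dpoisson s = 2 * s / (pi * (1 + s\<^sup>2)\<^sup>2)"

lemma poisson_kernel_deriv: "(poisson_kernel has_real_derivative - dpoisson s) (at s)"
proof -
  have u: "1 + s\<^sup>2 \<noteq> 0" using one_plus_square_pos[of s] by simp
  have "(poisson_kernel has_real_derivative - (pi * (2 * s)) / (pi * (1 + s\<^sup>2))\<^sup>2) (at s)"
    unfolding poisson_kernel_def[abs_def] using u
    by (auto intro!: derivative_eq_intros simp: power2_eq_square)
  also have "- (pi * (2 * s)) / (pi * (1 + s\<^sup>2))\<^sup>2 = - dpoisson s"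
    unfolding dpoisson_def by (simp add: power_mult_distrib power2_eq_square[of pi])
  finally show ?thesis .
qed

lemma dpoisson_continuous: "continuous_on A dpoisson"
  unfolding dpoisson_def using one_plus_square_pos
  by (intro continuous_intros) (auto simp: less_imp_neq[symmetric])

lemma dpoisson_measurable [measurable]: "dpoisson \<in> borel_measurable borel"
  by (rule borel_measurable_continuous_onI[OF dpoisson_continuous])

text \<open>Difference quotients of a Lipschitz primitive, taken over distance x |s| on scale x,
  grow linearly in |s|. This inequality absorbs that growth into an integrable majorant.\<close>

lemma dpoisson_bound: "\<bar>dpoisson s\<bar> * \<bar>s\<bar> \<le> 2 * poisson_kernel s"
proof -
  have "\<bar>dpoisson s\<bar> * \<bar>s\<bar> = 2 * s\<^sup>2 / (pi * (1 + s\<^sup>2)\<^sup>2)"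
    by (simp add: dpoisson_def abs_mult power2_eq_square)
  also have "\<dots> \<le> 2 * (1 + s\<^sup>2) / (pi * (1 + s\<^sup>2)\<^sup>2)"
    by (intro divide_right_mono) auto
  also have "\<dots> = 2 * poisson_kernel s"
  proof -
    have "2 * u / (pi * u\<^sup>2) = 2 * (1 / (pi * u))" if "u > 0" for u :: real
      using that by (simp add: field_simps power2_eq_square)
    then show ?thesis using one_plus_square_pos[of s] unfolding poisson_kernel_def by blast
  qed
  finally show ?thesis .
qed

text \<open>The kernel is even. The reflection converts the orientation of the contour formula into
  the convolution form with argument y - x s.\<close>

lemma integral_poisson_kernel_reflect:
  fixes f :: "real \<Rightarrow> complex"
  shows "(LINT s|lborel. complex_of_real (poisson_kernel s) * f s) =
    (LINT s|lborel. complex_of_real (poisson_kernel s) * f (- s))"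
  by (subst lborel_integral_real_affine[of "-1" _ 0]) (auto simp: poisson_kernel_def)

lemma HinftyE:
  assumes "\<phi> \<in> Hinfty"
  obtains M where "\<phi> holomorphic_on \<complex>\<^sup>+" "\<And>z. Re z > 0 \<Longrightarrow> norm (\<phi> z) \<le> M" "0 \<le> M"
proof -
  obtain M where "\<forall>z\<in>\<complex>\<^sup>+. norm (\<phi> z) \<le> M"
    using assms by (auto simp: Hinfty_def bounded_iff)
  moreover from this have "norm (\<phi> 1) \<le> M" by (auto simp: right_half_plane_def)
  then have "0 \<le> M" by (meson norm_ge_zero order_trans)
  ultimately show thesis using that assms by (auto simp: Hinfty_def right_half_plane_def)
qed

lemma has_vector_derivative_quotient_0:
  assumes "(f has_vector_derivative v) (at 0)"
  shows "((\<lambda>h. (f h - f 0) /\<^sub>R h) \<longlongrightarrow> v) (at 0)"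
proof -
  have "(\<lambda>h. norm (f (0 + h) - f 0 - h *\<^sub>R v) / norm h) \<midarrow>0\<rightarrow> 0"
    using assms unfolding has_vector_derivative_def has_derivative_at by blast
  moreover have "norm (f (0 + h) - f 0 - h *\<^sub>R v) / norm h = norm ((f h - f 0) /\<^sub>R h - v)" if "h \<noteq> 0" for h
  proof -
    have "(f h - f 0) /\<^sub>R h - v = (f (0 + h) - f 0 - h *\<^sub>R v) /\<^sub>R h"
      using that by (simp add: scaleR_diff_right)
    then show ?thesis by (simp add: divide_inverse mult.commute)
  qed
  ultimately have "(\<lambda>h. norm ((f h - f 0) /\<^sub>R h - v)) \<midarrow>0\<rightarrow> 0"
    by (subst LIM_equal[of 0 _ "\<lambda>h. norm (f (0 + h) - f 0 - h *\<^sub>R v) / norm h"]) auto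
  then show ?thesis by (simp add: tendsto_norm_zero_iff LIM_zero_iff)
qed

section \<open>The boundary primitive of a bounded holomorphic function\<close>

context
  fixes \<phi> :: "complex \<Rightarrow> complex" and M :: real
  assumes hol: "\<phi> holomorphic_on \<complex>\<^sup>+"
    and bd: "\<And>z. Re z > 0 \<Longrightarrow> norm (\<phi> z) \<le> M"
    and M: "0 \<le> M"
begin

lemma continuous_on_vertical_line:
  assumes "e > 0" shows "continuous_on A (\<lambda>s. \<phi> (Complex e (y - x * s)))"
proof -
  have "continuous_on \<complex>\<^sup>+ \<phi>" using hol by (rule holomorphic_on_imp_continuous_on)
  then show ?thesis
    using assms by (rule_tac continuous_on_compose2) 
      (auto simp: Complex_eq right_half_plane_def intro!: continuous_intros)
qed

text \<open>Apply the formula at 1 to z \<mapsto> \<open>\<phi>\<close>(e + i y + x z), which is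
  holomorphic for Re z > -e/x. The shift e > 0 supplies the margin beyond the imaginary axis that
  \<open>poisson_at_one\<close> asks for.\<close>

lemma poisson_shifted:
  assumes e: "e > 0" and x: "x > 0"
  shows "\<phi> (Complex (e + x) y) =
    (LINT s|lborel. complex_of_real (poisson_kernel s) * \<phi> (Complex e (y - x * s)))"
proof -
  define a where "a = (\<lambda>z. Complex e y + of_real x * z)"
  have Re_a: "Re (a z) > 0" if "Re z > - (e / x)" for z
    using that x by (simp add: a_def field_simps)
  have hola: "(\<phi> \<circ> a) holomorphic_on {z. Re z > - (e / x)}"
  proof (rule holomorphic_on_compose)
    show "a holomorphic_on {z. Re z > - (e / x)}" unfolding a_def by (intro holomorphic_intros)
    show "\<phi> holomorphic_on a ` {z. Re z > - (e / x)}"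
      by (rule holomorphic_on_subset[OF hol]) (auto simp: right_half_plane_def Re_a)
  qed
  have "(LINT s|lborel. complex_of_real (poisson_kernel s) * (\<phi> \<circ> a) (Complex 0 s)) = (\<phi> \<circ> a) 1"
    using e x by (intro poisson_at_one[OF _ hola, of M]) (auto intro!: bd Re_a)
  moreover have "a 1 = Complex (e + x) y" "a (Complex 0 (- s)) = Complex e (y - x * s)" for s
    by (auto simp: a_def complex_eq_iff)
  ultimately show ?thesis
    by (subst (asm) integral_poisson_kernel_reflect) (simp add: o_def)
qed

definition prim :: "complex \<Rightarrow> complex" where
  "prim = (SOME F. \<forall>z\<in>\<complex>\<^sup>+. (F has_field_derivative \<phi> z) (at z))"

lemma prim_deriv: "Re z > 0 \<Longrightarrow> (prim has_field_derivative \<phi> z) (at z)"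
proof -
  have o: "open \<complex>\<^sup>+" "convex \<complex>\<^sup>+"
    by (auto simp: right_half_plane_def open_halfspace_Re_gt convex_halfspace_Re_gt)
  have "\<exists>F. \<forall>z\<in>\<complex>\<^sup>+. (F has_field_derivative \<phi> z) (at z within \<complex>\<^sup>+)"
    using holomorphic_convex_primitive'[OF o(2) o(1) hol] by metis
  then have "\<exists>F. \<forall>z\<in>\<complex>\<^sup>+. (F has_field_derivative \<phi> z) (at z)"
    using o(1) by (metis at_within_open)
  from someI_ex[OF this] show "Re z > 0 \<Longrightarrow> (prim has_field_derivative \<phi> z) (at z)"
    unfolding prim_def by (auto simp: right_half_plane_def)
qed

lemma prim_lipschitz:
  assumes "Re z > 0" "Re w > 0" shows "norm (prim z - prim w) \<le> M * norm (z - w)"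
proof (rule field_differentiable_bound[of "\<complex>\<^sup>+" prim \<phi> M])
  show "convex \<complex>\<^sup>+" by (simp add: right_half_plane_def convex_halfspace_Re_gt)
qed (use assms bd in \<open>auto simp: right_half_plane_def intro: has_field_derivative_at_within prim_deriv\<close>)

text \<open>One fixed sequence of abscissas suffices: the Lipschitz bound makes the values Cauchy at
  every y, whereas for \<open>\<phi>\<close> itself the limit is obtained only almost
  everywhere.\<close>

definition boundary_primitive :: "real \<Rightarrow> complex" where
  "boundary_primitive y = lim (\<lambda>n. prim (Complex (1 / real (Suc n)) y))"

lemma prim_tendsto_boundary_primitive: "(\<lambda>n. prim (Complex (1 / real (Suc n)) y)) \<longlonglongrightarrow> boundary_primitive y"
proof -
  have c0: "Cauchy (\<lambda>n. 1 / real (Suc n))"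
    by (rule LIMSEQ_imp_Cauchy[of _ 0]) (rule LIMSEQ_Suc[OF lim_1_over_n, unfolded])
  have "Cauchy (\<lambda>n. prim (Complex (1 / real (Suc n)) y))"
  proof (rule CauchyI)
    fix e :: real assume "e > 0"
    \<comment> \<open>\<open>M\<close> may be 0, hence the divisor M + 1.\<close>
    then have "e / (M + 1) > 0" using M by simp
    then obtain N where N: "\<And>m n. m \<ge> N \<Longrightarrow> n \<ge> N \<Longrightarrow> norm (1 / real (Suc m) - 1 / real (Suc n)) < e / (M + 1)"
      using CauchyD[OF c0] by blast
    have "norm (prim (Complex (1 / real (Suc m)) y) - prim (Complex (1 / real (Suc n)) y)) < e"
      if "m \<ge> N" "n \<ge> N" for m n
    proof -
      have "Complex (1 / real (Suc m)) y - Complex (1 / real (Suc n)) y = of_real (1 / real (Suc m) - 1 / real (Suc n))"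
        by (simp add: complex_eq_iff)
      then have "norm (prim (Complex (1 / real (Suc m)) y) - prim (Complex (1 / real (Suc n)) y))
          \<le> M * norm (1 / real (Suc m) - 1 / real (Suc n))"
        using prim_lipschitz[of "Complex (1 / real (Suc m)) y" "Complex (1 / real (Suc n)) y"]
        by (simp del: of_nat_Suc of_real_diff)
      also have "\<dots> \<le> (M + 1) * norm (1 / real (Suc m) - 1 / real (Suc n))"
        by (intro mult_right_mono) auto
      also have "\<dots> < (M + 1) * (e / (M + 1))"
        using M N[OF that] by (intro mult_strict_left_mono) auto
      also have "\<dots> = e" using M by simp
      finally show ?thesis .
    qed
    then show "\<exists>N. \<forall>m\<ge>N. \<forall>n\<ge>N. norm (prim (Complex (1 / real (Suc m)) y) - prim (Complex (1 / real (Suc n)) y)) < e"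
      by blast
  qed
  then show ?thesis unfolding boundary_primitive_def using Cauchy_convergent convergent_LIMSEQ_iff by blast
qed

lemma boundary_primitive_lipschitz: "norm (boundary_primitive y - boundary_primitive t) \<le> M * \<bar>y - t\<bar>"
proof (rule tendsto_upperbound)
  show "(\<lambda>n. norm (prim (Complex (1 / real (Suc n)) y) - prim (Complex (1 / real (Suc n)) t))) \<longlonglongrightarrow>
      norm (boundary_primitive y - boundary_primitive t)"
    by (intro tendsto_intros prim_tendsto_boundary_primitive)
  have "norm (prim (Complex (1 / real (Suc n)) y) - prim (Complex (1 / real (Suc n)) t)) \<le> M * \<bar>y - t\<bar>" for n
  proof -
    have "Complex (1 / real (Suc n)) y - Complex (1 / real (Suc n)) t = of_real (y - t) * \<i>"
      by (simp add: complex_eq_iff)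
    then have "norm (Complex (1 / real (Suc n)) y - Complex (1 / real (Suc n)) t) = \<bar>y - t\<bar>"
      by (simp add: norm_mult del: of_real_diff)
    then show ?thesis
      using prim_lipschitz[of "Complex (1 / real (Suc n)) y" "Complex (1 / real (Suc n)) t"] by simp
  qed
  then show "\<forall>\<^sub>F n in sequentially. norm (prim (Complex (1 / real (Suc n)) y) - prim (Complex (1 / real (Suc n)) t)) \<le> M * \<bar>y - t\<bar>"
    by simp
qed simp

text \<open>The derivative of the kernel times \<open>U\<close> is f1 - f2, and the product vanishes
  at both infinities, so the integrals of f1 and f2 agree.\<close>

lemma poisson_by_parts:
  assumes e: "e > 0" and x: "x > 0"
  shows "\<phi> (Complex (e + x) y) =
    (LINT s|lborel. complex_of_real (dpoisson s) * (\<i> * (prim (Complex e (y - x * s)) - prim (Complex e y)) / of_real x))"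
proof -
  \<comment> \<open>Differentiating the primitive along s produces the factor -i x, which i/x turns
    into 1. Subtracting the value at s = 0 gives |U(s)| \<le> M |s|.\<close>
  define U where "U = (\<lambda>s. \<i> * (prim (Complex e (y - x * s)) - prim (Complex e y)) / of_real x)"
  define p where "p = (\<lambda>s. complex_of_real (poisson_kernel s))"
  define f1 where "f1 = (\<lambda>s. p s * \<phi> (Complex e (y - x * s)))"
  define f2 where "f2 = (\<lambda>s. complex_of_real (dpoisson s) * U s)"
  have U': "(U has_vector_derivative \<phi> (Complex e (y - x * s))) (at s)" for s
  proof -
    have "((\<lambda>s. Complex e (y - x * s)) has_vector_derivative - (x * \<i>)) (at s)"
      unfolding Complex_eq by (auto intro!: derivative_eq_intros)
    from field_vector_diff_chain_at[OF this prim_deriv[of "Complex e (y - x * s)"]]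
    have "((\<lambda>s. prim (Complex e (y - x * s))) has_vector_derivative - (x * \<i>) * \<phi> (Complex e (y - x * s))) (at s)"
      using e by (simp add: o_def)
    from has_vector_derivative_mult_right[OF has_vector_derivative_diff[OF this has_vector_derivative_const[of "prim (Complex e y)"]], of "\<i> / of_real x"]
    show ?thesis unfolding U_def using x by (simp add: field_simps)
  qed
  have Ule: "norm (U s) \<le> M * \<bar>s\<bar>" for s
  proof -
    have "Complex e (y - x * s) - Complex e y = of_real (- (x * s)) * \<i>" by (simp add: complex_eq_iff)
    then have "norm (Complex e (y - x * s) - Complex e y) = x * \<bar>s\<bar>"
      using x by (simp add: norm_mult abs_mult)
    then have "norm (prim (Complex e (y - x * s)) - prim (Complex e y)) \<le> (M * \<bar>s\<bar>) * x"
      using prim_lipschitz[of "Complex e (y - x * s)" "Complex e y"] e by (simp add: ac_simps)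
    moreover have "norm (U s) = norm (prim (Complex e (y - x * s)) - prim (Complex e y)) / x"
      using x by (simp add: U_def norm_mult norm_divide del: right_diff_distrib_numeral)
    ultimately show ?thesis using x by (simp add: pos_divide_le_eq)
  qed
  have Ucont: "continuous_on UNIV U"
    using U' by (meson continuous_at_imp_continuous_on has_vector_derivative_continuous)
  have p': "(p has_vector_derivative - complex_of_real (dpoisson s)) (at s)" for s
    unfolding p_def using has_vector_derivative_of_real[OF poisson_kernel_deriv[of s]]
    by simp
  have c1: "continuous_on UNIV f1" unfolding f1_def p_def
    by (intro continuous_intros continuous_on_vertical_line e continuous_poisson_kernel)
  have c2: "continuous_on UNIV f2" unfolding f2_def
    by (intro continuous_intros Ucont dpoisson_continuous)
  note [measurable] = borel_measurable_continuous_onI[OF c1] borel_measurable_continuous_onI[OF c2]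
  have i0: "integrable lborel (\<lambda>s. (2 * M) * poisson_kernel s)"
    by (intro integrable_mult_right integrable_poisson_kernel)
  have i1: "integrable lborel f1"
  proof (rule Bochner_Integration.integrable_bound[OF i0])
    show "AE s in lborel. norm (f1 s) \<le> norm (2 * M * poisson_kernel s)"
    proof (intro AE_I2)
      fix s
      have "norm (f1 s) \<le> poisson_kernel s * M"
        using bd[of "Complex e (y - x * s)"] e poisson_kernel_nonneg[of s]
        by (auto simp: f1_def p_def norm_mult intro!: mult_left_mono)
      also have "\<dots> \<le> norm (2 * M * poisson_kernel s)"
        using M poisson_kernel_nonneg[of s] by (simp add: abs_mult)
      finally show "norm (f1 s) \<le> norm (2 * M * poisson_kernel s)" .
    qed
  qed simp
  have i2: "integrable lborel f2"
  proof (rule Bochner_Integration.integrable_bound[OF i0])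
    show "AE s in lborel. norm (f2 s) \<le> norm (2 * M * poisson_kernel s)"
    proof (intro AE_I2)
      fix s
      have "norm (f2 s) \<le> \<bar>dpoisson s\<bar> * (M * \<bar>s\<bar>)"
        using Ule[of s] by (auto simp: f2_def norm_mult intro!: mult_left_mono)
      also have "\<dots> \<le> M * (2 * poisson_kernel s)"
        using mult_left_mono[OF dpoisson_bound[of s] M] by (simp add: algebra_simps)
      also have "\<dots> \<le> norm (2 * M * poisson_kernel s)"
        using M poisson_kernel_nonneg[of s] by (simp add: abs_mult)
      finally show "norm (f2 s) \<le> norm (2 * M * poisson_kernel s)" .
    qed
  qed simp
  \<comment> \<open>The kernel decays quadratically against linear growth of \<open>U\<close>, so
    the boundary terms are O(1/|s|).\<close>
  have lim0: "((\<lambda>s. p s * U s) \<longlongrightarrow> 0) F" if "F = at_top \<or> F = at_bot" for F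
  proof (rule Lim_null_comparison)
    have "norm (p s * U s) \<le> M * \<bar>s\<bar> / (pi * (1 + s\<^sup>2))" for s
    proof -
      have "norm (p s * U s) \<le> poisson_kernel s * (M * \<bar>s\<bar>)"
        using Ule[of s] poisson_kernel_nonneg[of s] by (auto simp: p_def norm_mult intro!: mult_left_mono)
      then show ?thesis by (simp add: poisson_kernel_def)
    qed
    then show "\<forall>\<^sub>F s in F. norm (p s * U s) \<le> M * \<bar>s\<bar> / (pi * (1 + s\<^sup>2))" by simp
    show "((\<lambda>s. M * \<bar>s\<bar> / (pi * (1 + s\<^sup>2))) \<longlongrightarrow> 0) F"
      using that by (elim disjE; hypsubst; real_asymp)
  qed
  have "(LBINT s=-\<infinity>..\<infinity>. f1 s - f2 s) = 0 - 0"
  proof (rule interval_integral_FTC_integrable)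
    show "((\<lambda>s. p s * U s) has_vector_derivative f1 s - f2 s) (at s)" for s
      using has_vector_derivative_mult[OF p'[of s] U'[of s]] by (simp add: f1_def f2_def)
    show "isCont (\<lambda>s. f1 s - f2 s) s" for s
      using c1 c2 by (intro continuous_intros) (auto simp: continuous_on_eq_continuous_at)
    show "set_integrable lborel (einterval (-\<infinity>) \<infinity>) (\<lambda>s. f1 s - f2 s)"
      using i1 i2 by (simp add: set_integrable_def)
    show "(((\<lambda>s. p s * U s) \<circ> real_of_ereal) \<longlongrightarrow> 0) (at_right (-\<infinity>))"
      using lim0 by (simp add: ereal_tendsto_simps)
    show "(((\<lambda>s. p s * U s) \<circ> real_of_ereal) \<longlongrightarrow> 0) (at_left \<infinity>)"
      using lim0 by (simp add: ereal_tendsto_simps)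
  qed simp
  then have "(LINT s|lborel. f1 s - f2 s) = 0"
    by (simp add: interval_lebesgue_integral_def set_lebesgue_integral_def)
  then have "(LINT s|lborel. f1 s) = (LINT s|lborel. f2 s)" using i1 i2 by simp
  then show ?thesis
    using poisson_shifted[OF e x, of y] unfolding f1_def f2_def p_def U_def by simp
qed

text \<open>Supplies the majorant for both passages to the limit: in the shift e, and in the
  distance x to the axis.\<close>

lemma dpoisson_times_le:
  assumes "norm z \<le> M * \<bar>s\<bar>"
  shows "norm (complex_of_real (dpoisson s) * z) \<le> 2 * M * poisson_kernel s"
proof -
  have "norm (complex_of_real (dpoisson s) * z) \<le> \<bar>dpoisson s\<bar> * (M * \<bar>s\<bar>)"
    using assms by (auto simp: norm_mult intro!: mult_left_mono)
  also have "\<dots> \<le> M * (2 * poisson_kernel s)"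
    using mult_left_mono[OF dpoisson_bound[of s] M] by (simp add: algebra_simps)
  finally show ?thesis by simp
qed

lemma boundary_primitive_continuous: "continuous_on A boundary_primitive"
  using boundary_primitive_lipschitz M
  by (intro lipschitz_on_continuous_on[of M]) (auto simp: lipschitz_on_def dist_norm)

text \<open>
  Only the boundary values of a primitive of \<open>\<phi>\<close> enter here, and these exist everywhere.
\<close>
lemma poisson_boundary_primitive:
  assumes x: "x > 0"
  shows "\<phi> (Complex x y) =
    (LINT s|lborel. complex_of_real (dpoisson s) * (\<i> * (boundary_primitive (y - x * s) - boundary_primitive y) / of_real x))"
proof -
  define e where "e = (\<lambda>n. 1 / real (Suc n))"
  have e: "e n > 0" for n by (simp add: e_def)
  have e0: "e \<longlonglongrightarrow> 0" unfolding e_def by real_asymp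
  define f where "f = (\<lambda>n s. complex_of_real (dpoisson s) *
    (\<i> * (prim (Complex (e n) (y - x * s)) - prim (Complex (e n) y)) / of_real x))"
  have prim_cont: "continuous_on UNIV (\<lambda>s. prim (Complex (e n) (y - x * s)))" for n
  proof -
    have "continuous_on {z. Re z > 0} prim"
      by (rule continuous_at_imp_continuous_on) (auto intro: DERIV_isCont prim_deriv)
    then show ?thesis
      using e by (rule_tac continuous_on_compose2) (auto simp: Complex_eq intro!: continuous_intros)
  qed
  have [measurable]: "f n \<in> borel_measurable borel" for n
    unfolding f_def using x
    by (intro borel_measurable_continuous_onI continuous_intros prim_cont dpoisson_continuous) auto
  have bcont: "continuous_on UNIV (\<lambda>s. boundary_primitive (y - x * s))"
    by (rule continuous_on_compose2[OF boundary_primitive_continuous[of UNIV]]) (auto intro!: continuous_intros)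
  have "(\<lambda>n. LINT s|lborel. f n s) \<longlonglongrightarrow>
    (LINT s|lborel. complex_of_real (dpoisson s) * (\<i> * (boundary_primitive (y - x * s) - boundary_primitive y) / of_real x))"
  proof (rule integral_dominated_convergence[where w="\<lambda>s. 2 * M * poisson_kernel s"])
    show "(\<lambda>s. complex_of_real (dpoisson s) * (\<i> * (boundary_primitive (y - x * s) - boundary_primitive y) / of_real x)) \<in> borel_measurable lborel"
      using x by (simp, intro borel_measurable_continuous_onI continuous_intros bcont dpoisson_continuous) auto
    show "integrable lborel (\<lambda>s. 2 * M * poisson_kernel s)"
      by (intro integrable_mult_right integrable_poisson_kernel)
    show "AE s in lborel. (\<lambda>n. f n s) \<longlonglongrightarrow>
      complex_of_real (dpoisson s) * (\<i> * (boundary_primitive (y - x * s) - boundary_primitive y) / of_real x)"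
      unfolding f_def e_def using x by (intro AE_I2 tendsto_intros prim_tendsto_boundary_primitive) auto
    show "AE s in lborel. norm (f n s) \<le> 2 * M * poisson_kernel s" for n
    proof (intro AE_I2)
      fix s
      have "Complex (e n) (y - x * s) - Complex (e n) y = of_real (- (x * s)) * \<i>" by (simp add: complex_eq_iff)
      then have "norm (Complex (e n) (y - x * s) - Complex (e n) y) = x * \<bar>s\<bar>"
        using x by (simp add: norm_mult abs_mult)
      then have "norm (prim (Complex (e n) (y - x * s)) - prim (Complex (e n) y)) \<le> (M * \<bar>s\<bar>) * x"
        using prim_lipschitz[of "Complex (e n) (y - x * s)" "Complex (e n) y"] e by (simp add: ac_simps)
      then show "norm (f n s) \<le> 2 * M * poisson_kernel s"
        unfolding f_def using x by (intro dpoisson_times_le) (simp add: norm_divide norm_mult pos_divide_le_eq del: right_diff_distrib_numeral)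
    qed
  qed auto
  moreover have "(LINT s|lborel. f n s) = \<phi> (Complex (e n + x) y)" for n
    unfolding f_def by (rule poisson_by_parts[OF e x, symmetric])
  moreover have "(\<lambda>n. \<phi> (Complex (e n + x) y)) \<longlonglongrightarrow> \<phi> (Complex x y)"
  proof (rule isCont_tendsto_compose[of _ \<phi>])
    show "isCont \<phi> (Complex x y)"
      using x holomorphic_on_imp_continuous_on[OF hol]
      by (subst (asm) continuous_on_eq_continuous_at)
        (auto simp: right_half_plane_def open_halfspace_Re_gt)
    have "(\<lambda>n. Complex (e n + x) y) \<longlonglongrightarrow> Complex (0 + x) y"
      by (intro tendsto_intros e0)
    then show "(\<lambda>n. Complex (e n + x) y) \<longlonglongrightarrow> Complex x y" by simp
  qed
  ultimately show ?thesis using LIMSEQ_unique by fastforce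
qed

text \<open>If D is the derivative at y, the quotient in the by-parts formula tends to -s D for
  every s as x tends to 0, while M |s| bounds it for all x. Dominated convergence then moves the
  limit inside the integral.\<close>

lemma radial_limit_of_differentiable:
  assumes "boundary_primitive differentiable (at y)"
  shows "\<exists>L. ((\<lambda>x. \<phi> (Complex x y)) \<longlongrightarrow> L) (at_right 0)"
proof -
  obtain D where D: "(boundary_primitive has_vector_derivative D) (at y)"
    using assms by (auto simp: vector_derivative_works)
  define L where "L = (LINT s|lborel. complex_of_real (dpoisson s) * (\<i> * (- (of_real s * D))))"
  have "((\<lambda>x. \<phi> (Complex x y)) \<longlongrightarrow> L) (at_right 0)"
  proof (rule tendsto_at_right_sequentially[of 0 1])
    fix X :: "nat \<Rightarrow> real"
    assume X: "\<And>n. 0 < X n" "\<And>n. X n < 1" "decseq X" "X \<longlonglongrightarrow> 0"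
    have "(\<lambda>n. LINT s|lborel. complex_of_real (dpoisson s) * (\<i> * (boundary_primitive (y - X n * s) - boundary_primitive y) / of_real (X n)))
      \<longlonglongrightarrow> L"
      unfolding L_def
    proof (rule integral_dominated_convergence[where w="\<lambda>s. 2 * M * poisson_kernel s"])
      show "integrable lborel (\<lambda>s. 2 * M * poisson_kernel s)"
        by (intro integrable_mult_right integrable_poisson_kernel)
      have "continuous_on UNIV (\<lambda>s. boundary_primitive (y - X n * s))" for n
        by (rule continuous_on_compose2[OF boundary_primitive_continuous[of UNIV]]) (auto intro!: continuous_intros)
      then show "(\<lambda>s. complex_of_real (dpoisson s) * (\<i> * (boundary_primitive (y - X n * s) - boundary_primitive y) / of_real (X n)))
          \<in> borel_measurable lborel" for n
        using X(1)[of n] by (simp, intro borel_measurable_continuous_onI continuous_intros dpoisson_continuous) auto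
      show "AE s in lborel. (\<lambda>n. complex_of_real (dpoisson s) * (\<i> * (boundary_primitive (y - X n * s) - boundary_primitive y) / of_real (X n)))
          \<longlonglongrightarrow> complex_of_real (dpoisson s) * (\<i> * (- (of_real s * D)))"
      proof (intro AE_I2)
        fix s
        have "((\<lambda>h. boundary_primitive (y - h * s)) has_vector_derivative - s *\<^sub>R D) (at 0)"
        proof -
          have "((\<lambda>h. y - h * s) has_vector_derivative - s) (at 0)"
            by (auto intro!: derivative_eq_intros)
          from vector_diff_chain_at[OF this, of boundary_primitive D] show ?thesis using D by (simp add: o_def)
        qed
        then have "((\<lambda>h. (boundary_primitive (y - h * s) - boundary_primitive (y - 0 * s)) /\<^sub>R h) \<longlongrightarrow> - s *\<^sub>R D) (at 0)"
          by (rule has_vector_derivative_quotient_0)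
        then have "(\<lambda>n. (boundary_primitive (y - X n * s) - boundary_primitive y) /\<^sub>R X n) \<longlonglongrightarrow> - s *\<^sub>R D"
          using X by (intro filterlim_compose[of "\<lambda>h. (boundary_primitive (y - h * s) - boundary_primitive y) /\<^sub>R h" _ "at 0" X])
            (auto simp: filterlim_at less_imp_neq[symmetric])
        then have "(\<lambda>n. complex_of_real (dpoisson s) * (\<i> * ((boundary_primitive (y - X n * s) - boundary_primitive y) /\<^sub>R X n)))
          \<longlonglongrightarrow> complex_of_real (dpoisson s) * (\<i> * (- s *\<^sub>R D))"
          by (intro tendsto_mult tendsto_const)
        then show "(\<lambda>n. complex_of_real (dpoisson s) * (\<i> * (boundary_primitive (y - X n * s) - boundary_primitive y) / of_real (X n)))
          \<longlonglongrightarrow> complex_of_real (dpoisson s) * (\<i> * (- (of_real s * D)))"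
          by (simp add: scaleR_conv_of_real divide_inverse ac_simps)
      qed
      show "AE s in lborel. norm (complex_of_real (dpoisson s) * (\<i> * (boundary_primitive (y - X n * s) - boundary_primitive y) / of_real (X n)))
          \<le> 2 * M * poisson_kernel s" for n
      proof (intro AE_I2 dpoisson_times_le)
        fix s
        show "norm (\<i> * (boundary_primitive (y - X n * s) - boundary_primitive y) / of_real (X n)) \<le> M * \<bar>s\<bar>"
          using boundary_primitive_lipschitz[of "y - X n * s" y] X(1)[of n]
          by (simp add: norm_divide norm_mult pos_divide_le_eq abs_mult ac_simps del: right_diff_distrib_numeral)
      qed
    qed auto
    then show "(\<lambda>n. \<phi> (Complex (X n) y)) \<longlonglongrightarrow> L"
      using poisson_boundary_primitive[OF X(1)] by simp
  qed simp
  then show ?thesis by blast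
qed

text \<open>Fatou's theorem for perpendicular approach: the boundary primitive is Lipschitz, so the
  exceptional points of the previous lemma are negligible.\<close>

lemma AE_boundary_fun:
  "AE y in lebesgue. ((\<lambda>x. \<phi> (Complex x y)) \<longlongrightarrow> boundary_fun \<phi> y) (at_right 0)"
proof -
  have "negligible {y. \<not> boundary_primitive differentiable (at y)}"
    by (rule lipschitz_complex_differentiable_negligible[OF boundary_primitive_lipschitz])
  then have "AE y in lebesgue. boundary_primitive differentiable (at y)"
    by (auto simp: negligible_iff_null_sets intro: AE_I')
  then show ?thesis
  proof eventually_elim
    case (elim y)
    then obtain L where L: "((\<lambda>x. \<phi> (Complex x y)) \<longlongrightarrow> L) (at_right 0)"
      using radial_limit_of_differentiable by blast
    moreover from L have "boundary_fun \<phi> y = L"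
      unfolding boundary_fun_def by (intro tendsto_Lim) auto
    ultimately show ?case by simp
  qed
qed

end

section \<open>Averages against a kernel and invariant means\<close>

lemma borel_measurable_lebesgue_AE_eq:
  fixes g :: "real \<Rightarrow> 'b::topological_space"
  assumes g: "g \<in> borel_measurable borel" and ae: "AE x in lebesgue. f x = g x"
  shows "f \<in> borel_measurable lebesgue"
proof (rule measurableI)
  fix A :: "'b set" assume A: "A \<in> sets borel"
  show "f -` A \<inter> space lebesgue \<in> sets lebesgue"
  proof (rule completion.in_sets_AE)
    show "AE x in lebesgue. x \<in> g -` A \<longleftrightarrow> x \<in> f -` A \<inter> space lebesgue"
      using ae by eventually_elim auto
    show "g -` A \<in> sets lebesgue" using measurable_sets[OF g A] by auto
  qed simp
qed simp

text \<open>Moves integrals from the completed measure to Borel representatives, for which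
  compositions stay measurable and Fubini's theorem can be applied over
  \<open>lborel\<close>.\<close>

lemma lebesgue_integral_AE_borel:
  fixes g :: "real \<Rightarrow> 'b::{banach, second_countable_topology}"
  assumes g: "g \<in> borel_measurable borel" and ae: "AE x in lebesgue. f x = g x"
  shows "(LINT x|lebesgue. f x) = (LINT x|lborel. g x)"
proof -
  have "(LINT x|lebesgue. f x) = (LINT x|lebesgue. g x)"
    using borel_measurable_lebesgue_AE_eq[OF g ae] g ae
    by (intro integral_cong_AE) (auto intro: measurable_completion)
  also have "\<dots> = (LINT x|lborel. g x)" using g by (intro integral_completion) auto
  finally show ?thesis .
qed

text \<open>A Lebesgue null set lies in a Borel null set, and invertible affine maps pull the latter
  back to a null set.\<close>

lemma AE_lebesgue_affine:
  fixes P :: "real \<Rightarrow> bool"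
  assumes "AE x in lebesgue. P x" "c \<noteq> 0"
  shows "AE x in lebesgue. P (t + c * x)"
proof -
  have "{x. \<not> P x} \<in> null_sets lebesgue"
    using assms(1) completion.AE_iff_null_sets[of P lborel] by simp
  then obtain N where N: "N \<in> null_sets lborel" "{x. \<not> P x} \<subseteq> N"
    unfolding null_sets_completion_iff2 by (elim bexE)
  have [measurable]: "N \<in> sets borel" using N(1) by (simp add: null_sets_def)
  have "AE x in lborel. t + c * x \<notin> N"
  proof (rule AE_borel_affine[OF assms(2)])
    show "Measurable.pred borel (\<lambda>x. x \<notin> N)" by measurable
    show "AE x in lborel. x \<notin> N" using N(1) by (rule AE_not_in)
  qed
  then have "AE x in lebesgue. t + c * x \<notin> N" by (rule AE_completion)
  then show ?thesis by eventually_elim (use N(2) in auto)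
qed

lemma AE_lebesgue_False: "\<not> (AE x::real in lebesgue. False)"
proof
  assume "AE x::real in lebesgue. False"
  then have "(UNIV :: real set) \<in> null_sets lebesgue"
    using completion.AE_iff_null_sets[of "\<lambda>_. False" "lborel :: real measure"] by simp
  then show False by (auto simp: null_sets_def)
qed

lemma LinftyI:
  assumes "\<psi> \<in> borel_measurable lebesgue" "AE x in lebesgue. norm (\<psi> x) \<le> B"
  shows "\<psi> \<in> Linfty"
proof -
  have "esssup lebesgue (\<lambda>x. ereal (norm (\<psi> x))) \<le> ereal B"
    using assms by (intro esssup_I) auto
  then show ?thesis using assms(1) by (auto simp: Linfty_def order_le_less_trans)
qed

lemma Linfty_measurable: "\<psi> \<in> Linfty \<Longrightarrow> \<psi> \<in> borel_measurable lebesgue"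
  by (simp add: Linfty_def)

text \<open>Conversion to a real number loses nothing: membership excludes infinity, and the
  essential supremum is nonnegative because Lebesgue measure is not zero.\<close>

lemma ereal_Linfty_norm:
  assumes "\<psi> \<in> Linfty"
  shows "esssup lebesgue (\<lambda>x. ereal (norm (\<psi> x))) = ereal (Linfty_norm \<psi>)"
    and Linfty_norm_nonneg: "0 \<le> Linfty_norm \<psi>"
proof -
  let ?e = "esssup lebesgue (\<lambda>x. ereal (norm (\<psi> x)))"
  have [measurable]: "\<psi> \<in> borel_measurable lebesgue" using assms by (rule Linfty_measurable)
  have "0 \<le> ?e"
  proof (rule ccontr)
    assume neg: "\<not> 0 \<le> ?e"
    have "AE x in lebesgue. ereal (norm (\<psi> x)) \<le> ?e" by (rule esssup_AE)
    then have "AE x::real in lebesgue. False"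
    proof eventually_elim
      case (elim x)
      then have "ereal (norm (\<psi> x)) < 0" using neg by (meson le_less_trans not_le)
      then show ?case by simp
    qed
    then show False using AE_lebesgue_False by blast
  qed
  moreover have "?e < \<infinity>" using assms by (simp add: Linfty_def)
  ultimately have "\<bar>?e\<bar> \<noteq> \<infinity>" "0 \<le> real_of_ereal ?e" by (auto simp: real_of_ereal_pos)
  then show "?e = ereal (Linfty_norm \<psi>)" "0 \<le> Linfty_norm \<psi>"
    by (auto simp: Linfty_norm_def ereal_real)
qed

lemma AE_Linfty_norm:
  assumes "\<psi> \<in> Linfty" shows "AE x in lebesgue. norm (\<psi> x) \<le> Linfty_norm \<psi>"
  using esssup_AE[of "\<lambda>x. ereal (norm (\<psi> x))" lebesgue] ereal_Linfty_norm[OF assms] by simp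

lemma Linfty_norm_le:
  assumes "\<psi> \<in> borel_measurable lebesgue" "AE x in lebesgue. norm (\<psi> x) \<le> B"
  shows "Linfty_norm \<psi> \<le> B"
proof -
  have "esssup lebesgue (\<lambda>x. ereal (norm (\<psi> x))) \<le> ereal B"
    using assms by (intro esssup_I) auto
  then show ?thesis using ereal_Linfty_norm[OF LinftyI[OF assms]] by simp
qed

lemma Linfty_borel_version:
  assumes "\<psi> \<in> Linfty"
  obtains \<eta> where "\<eta> \<in> borel_measurable borel" "\<And>x. norm (\<eta> x) \<le> Linfty_norm \<psi>"
    "AE x in lebesgue. \<psi> x = \<eta> x"
proof -
  let ?B = "Linfty_norm \<psi>"
  have [measurable]: "\<psi> \<in> borel_measurable lebesgue" using assms by (rule Linfty_measurable)
  have "(\<lambda>x. Re (\<psi> x)) \<in> borel_measurable lebesgue" "(\<lambda>x. Im (\<psi> x)) \<in> borel_measurable lebesgue"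
    by measurable
  from this[THEN completion_ex_borel_measurable_real]
  obtain u v where [measurable]: "u \<in> borel_measurable lborel" "v \<in> borel_measurable lborel"
    and uv: "AE x in lborel. Re (\<psi> x) = u x" "AE x in lborel. Im (\<psi> x) = v x"
    by blast
  define \<eta>0 where "\<eta>0 = (\<lambda>x. complex_of_real (u x) + \<i> * complex_of_real (v x))"
  \<comment> \<open>Cutting off makes the norm bound hold everywhere and changes values only on a
    null set.\<close>
  define \<eta> where "\<eta> = (\<lambda>x. if norm (\<eta>0 x) \<le> ?B then \<eta>0 x else 0)"
  have [measurable]: "\<eta>0 \<in> borel_measurable borel" unfolding \<eta>0_def by measurable
  show thesis
  proof
    show "\<eta> \<in> borel_measurable borel" unfolding \<eta>_def by measurable
    show "norm (\<eta> x) \<le> ?B" for x using Linfty_norm_nonneg[OF assms] by (simp add: \<eta>_def)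
    show "AE x in lebesgue. \<psi> x = \<eta> x"
      using AE_completion[OF uv(1)] AE_completion[OF uv(2)] AE_Linfty_norm[OF assms]
    proof eventually_elim
      case (elim x)
      then have "\<psi> x = \<eta>0 x" by (simp add: \<eta>0_def complex_eq_iff)
      then show ?case using elim by (simp add: \<eta>_def)
    qed
  qed
qed

lemma Linfty_const: "(\<lambda>x. c) \<in> Linfty"
  by (rule LinftyI[of _ "norm c"]) auto

lemma Linfty_add: "\<psi> \<in> Linfty \<Longrightarrow> \<eta> \<in> Linfty \<Longrightarrow> (\<lambda>x. \<psi> x + \<eta> x) \<in> Linfty"
proof (rule LinftyI[of _ "Linfty_norm \<psi> + Linfty_norm \<eta>"])
  assume *: "\<psi> \<in> Linfty" "\<eta> \<in> Linfty"
  show "AE x in lebesgue. norm (\<psi> x + \<eta> x) \<le> Linfty_norm \<psi> + Linfty_norm \<eta>"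
    using AE_Linfty_norm[OF *(1)] AE_Linfty_norm[OF *(2)]
    by eventually_elim (meson add_mono norm_triangle_le)
qed (auto dest!: Linfty_measurable)

lemma Linfty_cmult: "\<psi> \<in> Linfty \<Longrightarrow> (\<lambda>x. c * \<psi> x) \<in> Linfty"
proof (rule LinftyI[of _ "norm c * Linfty_norm \<psi>"])
  assume *: "\<psi> \<in> Linfty"
  show "AE x in lebesgue. norm (c * \<psi> x) \<le> norm c * Linfty_norm \<psi>"
    using AE_Linfty_norm[OF *] by eventually_elim (simp add: norm_mult mult_left_mono)
qed (auto dest: Linfty_measurable)

lemma prob_densities_borel_version:
  assumes "f \<in> prob_densities"
  obtains g where "g \<in> borel_measurable borel" "\<And>x. 0 \<le> g x" "integrable lborel g"
    "(LINT x|lborel. g x) = 1" "AE x in lebesgue. f x = g x"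
proof -
  have f: "integrable lebesgue f" "AE x in lebesgue. f x \<ge> 0" "integral\<^sup>L lebesgue f = 1"
    using assms by (auto simp: prob_densities_def)
  obtain u where [measurable]: "u \<in> borel_measurable lborel" and u: "AE x in lborel. f x = u x"
    using completion_ex_borel_measurable_real[of f lborel] f(1) by auto
  define g where "g = (\<lambda>x. max 0 (u x))"
  have gm[measurable]: "g \<in> borel_measurable borel" unfolding g_def by measurable
  have ae: "AE x in lebesgue. f x = g x"
    using AE_completion[OF u] f(2) by eventually_elim (simp add: g_def)
  show thesis
  proof
    have "integrable lebesgue g"
      using f(1) ae by (rule_tac Bochner_Integration.integrable_cong_AE_imp[OF f(1)])
        (auto simp: measurable_completion elim: eventually_mono)
    then show "integrable lborel g" by (simp add: integrable_completion)
    show "(LINT x|lborel. g x) = 1"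
      using lebesgue_integral_AE_borel[OF gm ae] f(3) by simp
    show "0 \<le> g x" for x by (simp add: g_def)
  qed (fact gm ae)+
qed

section \<open>Averages against a dilated probability density\<close>

text \<open>For \<theta> > 0 and bounded \<open>\<psi>\<close> this is convolution with the density
  t \<mapsto> K(t/\<theta>)/\<theta>, after the substitution t = \<theta> s: the kernel stays fixed
  and the dilation acts on the function.\<close>

definition kernel_avg :: "(real \<Rightarrow> real) \<Rightarrow> real \<Rightarrow> (real \<Rightarrow> complex) \<Rightarrow> real \<Rightarrow> complex" where
  "kernel_avg K \<theta> \<psi> y = (LINT s|lebesgue. complex_of_real (K s) * \<psi> (y - \<theta> * s))"

text \<open>The L1 distance between the density and its translate by h.\<close>

definition translation_error :: "(real \<Rightarrow> real) \<Rightarrow> real \<Rightarrow> real" where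
  "translation_error K h = (LINT s|lborel. \<bar>K (s - h) - K s\<bar>)"

locale prob_kernel =
  fixes K :: "real \<Rightarrow> real"
  assumes K_meas [measurable]: "K \<in> borel_measurable borel"
    and K_nonneg: "\<And>s. 0 \<le> K s"
    and K_int: "integrable lborel K"
    and K_one: "(LINT s|lborel. K s) = 1"
begin

text \<open>A nonzero \<theta> makes s \<mapsto> y - \<theta> s invertible, so equality almost
  everywhere survives the composition.\<close>

lemma kernel_avg_borel:
  assumes [measurable]: "\<eta> \<in> borel_measurable borel" and ae: "AE x in lebesgue. \<psi> x = \<eta> x"
    and \<theta>: "\<theta> \<noteq> 0"
  shows "kernel_avg K \<theta> \<psi> y = (LINT s|lborel. complex_of_real (K s) * \<eta> (y - \<theta> * s))"
  unfolding kernel_avg_def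
proof (rule lebesgue_integral_AE_borel)
  have "AE s in lebesgue. \<psi> (y + (- \<theta>) * s) = \<eta> (y + (- \<theta>) * s)"
    using \<theta> by (intro AE_lebesgue_affine[OF ae]) auto
  then show "AE s in lebesgue. complex_of_real (K s) * \<psi> (y - \<theta> * s) = complex_of_real (K s) * \<eta> (y - \<theta> * s)"
    by eventually_elim simp
qed measurable

lemma integrable_kernel_times:
  fixes u :: "real \<Rightarrow> complex"
  assumes [measurable]: "u \<in> borel_measurable borel" and "\<And>s. norm (u s) \<le> B"
  shows "integrable lborel (\<lambda>s. complex_of_real (K s) * u s)"
proof (rule Bochner_Integration.integrable_bound)
  show "integrable lborel (\<lambda>s. B * K s)" using K_int by (rule integrable_mult_right)
  have "norm (K s * u s) \<le> norm (B * K s)" for s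
    using mult_left_mono[OF assms(2)[of s] K_nonneg[of s]] K_nonneg[of s] order_trans[OF norm_ge_zero assms(2)[of s]]
    by (simp add: norm_mult abs_mult mult.commute[of B])
  then show "AE s in lborel. norm (K s * u s) \<le> norm (B * K s)" by simp
qed measurable

lemma norm_kernel_integral_le:
  fixes u :: "real \<Rightarrow> complex"
  assumes [measurable]: "u \<in> borel_measurable borel" and "\<And>s. norm (u s) \<le> B"
  shows "norm (LINT s|lborel. complex_of_real (K s) * u s) \<le> B"
proof -
  have "norm (LINT s|lborel. complex_of_real (K s) * u s) \<le> (LINT s|lborel. B * K s)"
  proof (rule order_trans[OF integral_norm_bound integral_mono])
    show "integrable lborel (\<lambda>s. norm (complex_of_real (K s) * u s))"
      by (intro integrable_norm integrable_kernel_times[of _ B] assms)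
    show "integrable lborel (\<lambda>s. B * K s)" using K_int by (rule integrable_mult_right)
    show "norm (complex_of_real (K s) * u s) \<le> B * K s" for s
      using mult_left_mono[OF assms(2)[of s] K_nonneg[of s]] K_nonneg[of s]
      by (simp add: norm_mult mult.commute[of B])
  qed
  then show ?thesis using K_one by simp
qed

lemma kernel_avg_norm_le:
  assumes "\<psi> \<in> Linfty" "\<theta> \<noteq> 0"
  shows "norm (kernel_avg K \<theta> \<psi> y) \<le> Linfty_norm \<psi>"
proof -
  obtain \<eta> where \<eta>: "\<eta> \<in> borel_measurable borel" "\<And>x. norm (\<eta> x) \<le> Linfty_norm \<psi>"
    "AE x in lebesgue. \<psi> x = \<eta> x"
    using Linfty_borel_version[OF assms(1)] by metis
  note [measurable] = \<eta>(1)
  show ?thesis unfolding kernel_avg_borel[OF \<eta>(1,3) assms(2)]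
    by (intro norm_kernel_integral_le \<eta>(2)) measurable
qed

lemma kernel_avg_cong_AE:
  assumes "\<psi> \<in> Linfty" "\<eta> \<in> Linfty" "AE x in lebesgue. \<psi> x = \<eta> x" "\<theta> \<noteq> 0"
  shows "kernel_avg K \<theta> \<psi> y = kernel_avg K \<theta> \<eta> y"
proof -
  obtain \<nu> where \<nu>: "\<nu> \<in> borel_measurable borel" "AE x in lebesgue. \<eta> x = \<nu> x"
    using Linfty_borel_version[OF assms(2)] by metis
  moreover have "AE x in lebesgue. \<psi> x = \<nu> x" using assms(3) \<nu>(2) by eventually_elim simp
  ultimately show ?thesis
    using kernel_avg_borel[of \<nu> \<psi> \<theta> y] kernel_avg_borel[of \<nu> \<eta> \<theta> y] assms(4) by simp
qed

lemma kernel_avg_add: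
  assumes "\<psi> \<in> Linfty" "\<eta> \<in> Linfty" "\<theta> \<noteq> 0"
  shows "kernel_avg K \<theta> (\<lambda>x. \<psi> x + \<eta> x) y = kernel_avg K \<theta> \<psi> y + kernel_avg K \<theta> \<eta> y"
proof -
  obtain u where u: "u \<in> borel_measurable borel" "\<And>x. norm (u x) \<le> Linfty_norm \<psi>" "AE x in lebesgue. \<psi> x = u x"
    using Linfty_borel_version[OF assms(1)] by metis
  obtain v where v: "v \<in> borel_measurable borel" "\<And>x. norm (v x) \<le> Linfty_norm \<eta>" "AE x in lebesgue. \<eta> x = v x"
    using Linfty_borel_version[OF assms(2)] by metis
  note [measurable] = u(1) v(1)
  have ae: "AE x in lebesgue. \<psi> x + \<eta> x = u x + v x"
    using u(3) v(3) by eventually_elim simp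
  have "integrable lborel (\<lambda>s. complex_of_real (K s) * u (y - \<theta> * s))"
    by (rule integrable_kernel_times[OF _ u(2)]) measurable
  moreover have "integrable lborel (\<lambda>s. complex_of_real (K s) * v (y - \<theta> * s))"
    by (rule integrable_kernel_times[OF _ v(2)]) measurable
  moreover have "kernel_avg K \<theta> (\<lambda>x. \<psi> x + \<eta> x) y = (LINT s|lborel. complex_of_real (K s) * (u (y - \<theta> * s) + v (y - \<theta> * s)))"
    by (rule kernel_avg_borel[OF _ ae assms(3)]) measurable
  ultimately show ?thesis
    unfolding kernel_avg_borel[OF u(1,3) assms(3)] kernel_avg_borel[OF v(1,3) assms(3)]
    by (simp add: distrib_left)
qed

lemma kernel_avg_cmult: "kernel_avg K \<theta> (\<lambda>x. c * \<psi> x) y = c * kernel_avg K \<theta> \<psi> y"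
proof -
  have "complex_of_real (K s) * (c * \<psi> (y - \<theta> * s)) = c * (complex_of_real (K s) * \<psi> (y - \<theta> * s))" for s
    by (rule mult.left_commute)
  then show ?thesis unfolding kernel_avg_def by (simp only: integral_mult_right_zero)
qed

lemma kernel_avg_const: "kernel_avg K \<theta> (\<lambda>x. c) y = c"
proof -
  have "(LINT s|lebesgue. complex_of_real (K s)) = complex_of_real (LINT s|lborel. K s)"
    by (subst integral_completion) auto
  then show ?thesis using K_one unfolding kernel_avg_def by simp
qed

lemma kernel_avg_nonneg:
  assumes "\<psi> \<in> Linfty" "AE x in lebesgue. \<psi> x \<in> \<real>\<^sub>\<ge>\<^sub>0" "\<theta> \<noteq> 0"
  shows "kernel_avg K \<theta> \<psi> y \<in> \<real>\<^sub>\<ge>\<^sub>0"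
proof -
  \<comment> \<open>Replacing the function by |Re| of itself makes the integrand real and
    nonnegative everywhere without changing the average.\<close>
  have *: "kernel_avg K \<theta> \<psi> y = kernel_avg K \<theta> (\<lambda>x. complex_of_real \<bar>Re (\<psi> x)\<bar>) y"
  proof (rule kernel_avg_cong_AE[OF assms(1) _ _ assms(3)])
    show "AE x in lebesgue. \<psi> x = complex_of_real \<bar>Re (\<psi> x)\<bar>"
      using assms(2) by eventually_elim (auto simp: nonneg_Reals_def complex_eq_iff)
    have [measurable]: "\<psi> \<in> borel_measurable lebesgue" using assms(1) by (rule Linfty_measurable)
    show "(\<lambda>x. complex_of_real \<bar>Re (\<psi> x)\<bar>) \<in> Linfty"
    proof (rule LinftyI)
      show "AE x in lebesgue. norm (complex_of_real \<bar>Re (\<psi> x)\<bar>) \<le> Linfty_norm \<psi>"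
        using AE_Linfty_norm[OF assms(1)]
        by eventually_elim (simp add: order_trans[OF abs_Re_le_cmod])
    qed measurable
  qed
  have "kernel_avg K \<theta> (\<lambda>x. complex_of_real \<bar>Re (\<psi> x)\<bar>) y = complex_of_real (LINT s|lebesgue. K s * \<bar>Re (\<psi> (y - \<theta> * s))\<bar>)"
    unfolding kernel_avg_def by (simp flip: of_real_mult)
  moreover have "0 \<le> (LINT s|lebesgue. K s * \<bar>Re (\<psi> (y - \<theta> * s))\<bar>)"
    using K_nonneg by (intro integral_nonneg_AE) auto
  ultimately show ?thesis unfolding * by simp
qed

lemma scaled_kernel_density:
  assumes "\<theta> > 0" shows "(\<lambda>t. K (t / \<theta>) / \<theta>) \<in> prob_densities"
proof -
  have "integrable lborel (\<lambda>t. K (0 + (1 / \<theta>) * t))"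
    using assms by (intro lborel_integrable_real_affine K_int) auto
  then have i: "integrable lborel (\<lambda>t. K (t / \<theta>) / \<theta>)" by simp
  have "(LINT t|lborel. K (t / \<theta>) / \<theta>) = 1"
    using lborel_integral_real_affine[of "1 / \<theta>" K 0] K_one assms by simp
  then show ?thesis
    using i K_nonneg assms by (auto simp: prob_densities_def integrable_completion integral_completion)
qed

text \<open>Identifies the averages with convolutions by probability densities, which is what lets
  topological invariance act on them.\<close>

lemma convol_scaled_kernel:
  assumes "\<psi> \<in> Linfty" "\<theta> > 0"
  shows "convol (\<lambda>t. K (t / \<theta>) / \<theta>) \<psi> y = kernel_avg K \<theta> \<psi> y"
proof -
  obtain \<eta> where \<eta>: "\<eta> \<in> borel_measurable borel" "AE x in lebesgue. \<psi> x = \<eta> x"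
    using Linfty_borel_version[OF assms(1)] by metis
  note [measurable] = \<eta>(1)
  have "AE t in lebesgue. \<psi> (y + (- 1) * t) = \<eta> (y + (- 1) * t)"
    by (intro AE_lebesgue_affine[OF \<eta>(2)]) auto
  then have ae: "AE t in lebesgue. \<psi> (y - t) * complex_of_real (K (t / \<theta>) / \<theta>) = \<eta> (y - t) * complex_of_real (K (t / \<theta>) / \<theta>)"
    by eventually_elim simp
  have "convol (\<lambda>t. K (t / \<theta>) / \<theta>) \<psi> y = (LINT t|lborel. \<eta> (y - t) * complex_of_real (K (t / \<theta>) / \<theta>))"
    unfolding convol_def by (rule lebesgue_integral_AE_borel[OF _ ae]) measurable
  also have "\<dots> = \<bar>\<theta>\<bar> *\<^sub>R (LINT s|lborel. \<eta> (y - (0 + \<theta> * s)) * complex_of_real (K ((0 + \<theta> * s) / \<theta>) / \<theta>))"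
    using assms(2) by (intro lborel_integral_real_affine) auto
  also have "\<dots> = (LINT s|lborel. complex_of_real (K s) * \<eta> (y - \<theta> * s))"
    using assms(2) by (simp add: scaleR_conv_of_real mult.commute)
  also have "\<dots> = kernel_avg K \<theta> \<psi> y"
    using assms(2) by (intro kernel_avg_borel[OF \<eta>, symmetric]) auto
  finally show ?thesis .
qed

end

lemma convol_borel:
  assumes \<eta>: "\<eta> \<in> borel_measurable borel" "AE x in lebesgue. \<psi> x = \<eta> x"
    and g: "g \<in> borel_measurable borel" "AE x in lebesgue. f x = g x"
  shows "convol f \<psi> x = (LINT t|lborel. complex_of_real (g t) * \<eta> (x - t))"
proof -
  note [measurable] = \<eta>(1) g(1)
  have "AE t in lebesgue. \<psi> (x + (- 1) * t) = \<eta> (x + (- 1) * t)"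
    by (intro AE_lebesgue_affine[OF \<eta>(2)]) auto
  then have ae: "AE t in lebesgue. \<psi> (x - t) * complex_of_real (f t) = complex_of_real (g t) * \<eta> (x - t)"
    using g(2) by eventually_elim simp
  show ?thesis
    unfolding convol_def by (rule lebesgue_integral_AE_borel[OF _ ae]) measurable
qed

lemma convol_Linfty:
  assumes "f \<in> prob_densities" "\<psi> \<in> Linfty"
  shows "convol f \<psi> \<in> Linfty" "convol f \<psi> \<in> borel_measurable borel"
proof -
  obtain \<eta> where \<eta>: "\<eta> \<in> borel_measurable borel" "\<And>x. norm (\<eta> x) \<le> Linfty_norm \<psi>" "AE x in lebesgue. \<psi> x = \<eta> x"
    using Linfty_borel_version[OF assms(2)] by metis
  obtain g where g: "g \<in> borel_measurable borel" "\<And>x. 0 \<le> g x" "integrable lborel g"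
    "(LINT x|lborel. g x) = 1" "AE x in lebesgue. f x = g x"
    using prob_densities_borel_version[OF assms(1)] by metis
  note [measurable] = \<eta>(1) g(1)
  interpret g: prob_kernel g by unfold_locales (use g in auto)
  have eq: "convol f \<psi> = (\<lambda>x. LINT t|lborel. complex_of_real (g t) * \<eta> (x - t))"
    using convol_borel[OF \<eta>(1,3) g(1,5)] by (simp add: fun_eq_iff)
  show m: "convol f \<psi> \<in> borel_measurable borel"
    unfolding eq by measurable
  have "norm (convol f \<psi> x) \<le> Linfty_norm \<psi>" for x
    unfolding eq by (intro g.norm_kernel_integral_le \<eta>(2)) measurable
  then show "convol f \<psi> \<in> Linfty"
    using m by (intro LinftyI[of _ "Linfty_norm \<psi>"]) (auto intro: measurable_completion)
qed

section \<open>Asymptotic invariance of the dilated kernels\<close>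

context prob_kernel
begin

lemma integrable_translate: "integrable lborel (\<lambda>s. K (s - h))"
  using lborel_integrable_real_affine[OF K_int, of 1 "- h"] by simp

lemma integral_translate: "(LINT s|lborel. K (s - h)) = 1"
  using lborel_integral_real_affine[of 1 K "- h"] K_one by simp

lemma translation_error_bounds: "0 \<le> translation_error K h" "translation_error K h \<le> 2"
proof -
  show "0 \<le> translation_error K h" unfolding translation_error_def by simp
  have "translation_error K h \<le> (LINT s|lborel. K (s - h) + K s)"
    unfolding translation_error_def
  proof (rule integral_mono)
    show "\<bar>K (s - h) - K s\<bar> \<le> K (s - h) + K s" for s
      using K_nonneg[of "s - h"] K_nonneg[of s] by linarith
  qed (auto intro!: integrable_translate K_int)
  also have "\<dots> = 2" using integral_translate K_one integrable_translate K_int by simp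
  finally show "translation_error K h \<le> 2" .
qed

lemma translation_error_measurable [measurable]: "translation_error K \<in> borel_measurable borel"
  unfolding translation_error_def[abs_def] by measurable

text \<open>Translates converge pointwise wherever \<open>K\<close> is continuous, and all have mass
  1; Scheffe's lemma upgrades this to L1 convergence.\<close>

lemma translation_error_tendsto:
  assumes cont: "AE s in lborel. isCont K s" and h: "h \<longlonglongrightarrow> 0"
  shows "(\<lambda>n. translation_error K (h n)) \<longlonglongrightarrow> 0"
proof -
  have nn: "(\<integral>\<^sup>+s. norm (K (s - c)) \<partial>lborel) = 1" for c
    using nn_integral_eq_integral[OF integrable_translate[of c]] K_nonneg integral_translate[of c] by simp
  have "(\<lambda>n. \<integral>\<^sup>+s. norm (K (s - h n) - K s) \<partial>lborel) \<longlonglongrightarrow> 0"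
  proof (rule Scheffe_lemma2[OF _ K_int])
    show "AE s in lborel. (\<lambda>n. K (s - h n)) \<longlonglongrightarrow> K s"
      using cont
    proof eventually_elim
      case (elim s)
      have "(\<lambda>n. s - h n) \<longlonglongrightarrow> s - 0" by (intro tendsto_intros h)
      then show ?case using isCont_tendsto_compose[OF elim] by simp
    qed
    show "(\<integral>\<^sup>+s. norm (K (s - h n)) \<partial>lborel) \<le> (\<integral>\<^sup>+s. norm (K s) \<partial>lborel)" for n
      using nn[of "h n"] nn[of 0] by simp
  qed measurable
  moreover have "(\<integral>\<^sup>+s. norm (K (s - h n) - K s) \<partial>lborel) = ennreal (translation_error K (h n))" for n
    unfolding translation_error_def real_norm_def
    by (intro nn_integral_eq_integral integrable_abs Bochner_Integration.integrable_diff integrable_translate K_int) auto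
  ultimately have "(\<lambda>n. ennreal (translation_error K (h n))) \<longlonglongrightarrow> 0" by simp
  then show ?thesis
    using translation_error_bounds(1) by (subst (asm) tendsto_ennreal_iff[of _ _ 0, simplified]) auto
qed

text \<open>A translation by fixed t becomes t/\<theta> after dilation, hence negligible in the
  limit for each t. The uniform bound 2 on the error permits dominated convergence against
  \<open>g\<close>.\<close>

lemma integral_translation_error_tendsto:
  assumes cont: "AE s in lborel. isCont K s"
    and g: "integrable lborel g" "\<And>t. 0 \<le> g t" and \<theta>: "filterlim \<theta> at_top sequentially"
  shows "(\<lambda>n. LINT t|lborel. g t * translation_error K (t / \<theta> n)) \<longlonglongrightarrow> 0"
proof -
  have [measurable]: "g \<in> borel_measurable borel" using borel_measurable_integrable[OF g(1)] by simp
  have "(\<lambda>n. LINT t|lborel. g t * translation_error K (t / \<theta> n)) \<longlonglongrightarrow> (LINT t::real|lborel. (0::real))"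
  proof (rule integral_dominated_convergence[where w="\<lambda>t. 2 * g t"])
    show "integrable lborel (\<lambda>t. 2 * g t)" using g(1) by simp
    show "AE t in lborel. (\<lambda>n. g t * translation_error K (t / \<theta> n)) \<longlonglongrightarrow> 0"
    proof (intro AE_I2)
      fix t
      have "(\<lambda>n. t / \<theta> n) \<longlonglongrightarrow> 0"
        by (rule real_tendsto_divide_at_top[OF tendsto_const \<theta>])
      then have "(\<lambda>n. g t * translation_error K (t / \<theta> n)) \<longlonglongrightarrow> g t * 0"
        by (intro tendsto_mult tendsto_const translation_error_tendsto[OF cont])
      then show "(\<lambda>n. g t * translation_error K (t / \<theta> n)) \<longlonglongrightarrow> 0" by simp
    qed
    show "AE t in lborel. norm (g t * translation_error K (t / \<theta> n)) \<le> 2 * g t" for n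
      using mult_left_mono[OF translation_error_bounds(2) g(2)] translation_error_bounds(1) g(2)
      by (auto simp: abs_mult mult.commute)
  qed auto
  then show ?thesis by simp
qed

text \<open>By Fubini, averaging the convolution means mixing, with weight \<open>g\<close>, the
  averages at centres y - t. Moving the centre by t amounts to translating \<open>K\<close> by
  t/\<theta>, so the change is controlled by the translation error.\<close>

lemma kernel_avg_convol_diff:
  assumes \<psi>: "\<psi> \<in> Linfty" and \<theta>: "\<theta> > 0"
    and \<eta>: "\<eta> \<in> borel_measurable borel" "\<And>x. norm (\<eta> x) \<le> Linfty_norm \<psi>" "AE x in lebesgue. \<psi> x = \<eta> x"
    and g: "g \<in> borel_measurable borel" "\<And>t. 0 \<le> g t" "integrable lborel g"
      "(LINT t|lborel. g t) = 1" "AE t in lebesgue. f t = g t"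
  shows "norm (kernel_avg K \<theta> (convol f \<psi>) y - kernel_avg K \<theta> \<psi> y) \<le>
    Linfty_norm \<psi> * (LINT t|lborel. g t * translation_error K (t / \<theta>))"
proof -
  interpret g: prob_kernel g by unfold_locales (use g in auto)
  note [measurable] = \<eta>(1) g(1)
  let ?B = "Linfty_norm \<psi>"
  define c where "c = (\<lambda>x. LINT t|lborel. complex_of_real (g t) * \<eta> (x - t))"
  have c: "convol f \<psi> = c"
    unfolding c_def using convol_borel[OF \<eta>(1,3) g(1,5)] by (simp add: fun_eq_iff)
  have [measurable]: "c \<in> borel_measurable borel" unfolding c_def by measurable
  define a where "a = (\<lambda>t. LINT s|lborel. complex_of_real (K s) * \<eta> (y - t - \<theta> * s))"
  have [measurable]: "a \<in> borel_measurable borel" unfolding a_def by measurable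
  have a0: "kernel_avg K \<theta> \<psi> y = a 0"
    unfolding a_def using kernel_avg_borel[OF \<eta>(1,3), of \<theta> y] \<theta> by simp
  have a_le: "norm (a t) \<le> ?B" for t
    unfolding a_def by (intro norm_kernel_integral_le \<eta>(2)) measurable
  have adiff: "norm (a t - a 0) \<le> ?B * translation_error K (t / \<theta>)" for t
  proof -
    \<comment> \<open>The substitution s \<mapsto> s - t/\<theta> moves the translation from the
      function, which is merely bounded and measurable, onto the kernel.\<close>
    have "a t = (LINT s|lborel. complex_of_real (K (- (t / \<theta>) + 1 * s)) * \<eta> (y - t - \<theta> * (- (t / \<theta>) + 1 * s)))"
      unfolding a_def by (subst lborel_integral_real_affine[of 1 _ "- (t / \<theta>)"]) auto
    also have "\<dots> = (LINT s|lborel. complex_of_real (K (s - t / \<theta>)) * \<eta> (y - \<theta> * s))"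
      using \<theta> by (simp add: algebra_simps)
    finally have at: "a t = (LINT s|lborel. complex_of_real (K (s - t / \<theta>)) * \<eta> (y - \<theta> * s))" .
    interpret T: prob_kernel "\<lambda>s. K (s - t / \<theta>)"
      by unfold_locales (auto intro: K_nonneg integrable_translate integral_translate)
    have i1: "integrable lborel (\<lambda>s. complex_of_real (K (s - t / \<theta>)) * \<eta> (y - \<theta> * s))"
      by (rule T.integrable_kernel_times[OF _ \<eta>(2)]) measurable
    have i2: "integrable lborel (\<lambda>s. complex_of_real (K s) * \<eta> (y - \<theta> * s))"
      by (rule integrable_kernel_times[OF _ \<eta>(2)]) measurable
    have "a t - a 0 = (LINT s|lborel. complex_of_real (K (s - t / \<theta>) - K s) * \<eta> (y - \<theta> * s))"
      using Bochner_Integration.integral_diff[OF i1 i2] unfolding at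
      by (simp add: a_def left_diff_distrib)
    also have "norm \<dots> \<le> (LINT s|lborel. ?B * \<bar>K (s - t / \<theta>) - K s\<bar>)"
    proof (rule order_trans[OF integral_norm_bound integral_mono])
      show "integrable lborel (\<lambda>s. norm (complex_of_real (K (s - t / \<theta>) - K s) * \<eta> (y - \<theta> * s)))"
        using Bochner_Integration.integrable_diff[OF i1 i2]
        by (intro integrable_norm) (simp add: left_diff_distrib)
      show "integrable lborel (\<lambda>s. ?B * \<bar>K (s - t / \<theta>) - K s\<bar>)"
        by (intro integrable_mult_right integrable_abs Bochner_Integration.integrable_diff integrable_translate K_int)
      show "norm (complex_of_real (K (s - t / \<theta>) - K s) * \<eta> (y - \<theta> * s)) \<le> ?B * \<bar>K (s - t / \<theta>) - K s\<bar>" for s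
        using mult_left_mono[OF \<eta>(2)[of "y - \<theta> * s"], of "\<bar>K (s - t / \<theta>) - K s\<bar>"]
        by (simp add: norm_mult mult.commute[of ?B] del: of_real_diff)
    qed
    also have "\<dots> = ?B * translation_error K (t / \<theta>)"
      unfolding translation_error_def by simp
    finally show ?thesis .
  qed
  have "kernel_avg K \<theta> (convol f \<psi>) y = (LINT s|lborel. complex_of_real (K s) * c (y - \<theta> * s))"
    unfolding c by (rule kernel_avg_borel) (use \<theta> in auto)
  also have "\<dots> = (LINT s|lborel. (LINT t|lborel. complex_of_real (K s) * (complex_of_real (g t) * \<eta> (y - \<theta> * s - t))))"
    unfolding c_def by simp
  \<comment> \<open>Exchange of integrals: the integrand is bounded by the norm of
    \<open>\<psi>\<close> times g(t) K(s), which is integrable on the plane.\<close>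
  also have "\<dots> = (LINT t|lborel. (LINT s|lborel. complex_of_real (K s) * (complex_of_real (g t) * \<eta> (y - \<theta> * s - t))))"
  proof (rule lborel_pair.Fubini_integral)
    show "integrable (lborel \<Otimes>\<^sub>M lborel)
      (\<lambda>(t, s). complex_of_real (K s) * (complex_of_real (g t) * \<eta> (y - \<theta> * s - t)))"
    proof (rule lborel_pair.Fubini_integrable)
      have le: "norm (complex_of_real (g t) * \<eta> (y - \<theta> * s - t)) \<le> ?B * g t" for s t
        using mult_left_mono[OF \<eta>(2) g(2)[of t]] g(2)[of t] by (simp add: norm_mult mult.commute[of ?B])
      have i: "integrable lborel (\<lambda>s. complex_of_real (K s) * (complex_of_real (g t) * \<eta> (y - \<theta> * s - t)))" for t
        by (rule integrable_kernel_times[OF _ le]) measurable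
      then show "AE t in lborel. integrable lborel (\<lambda>s. case (t, s) of (t, s) \<Rightarrow>
          complex_of_real (K s) * (complex_of_real (g t) * \<eta> (y - \<theta> * s - t)))" by simp
      show "integrable lborel (\<lambda>t. LINT s|lborel. norm (case (t, s) of (t, s) \<Rightarrow>
          complex_of_real (K s) * (complex_of_real (g t) * \<eta> (y - \<theta> * s - t))))"
      proof (rule Bochner_Integration.integrable_bound)
        show "integrable lborel (\<lambda>t. ?B * g t)" using g(3) by (rule integrable_mult_right)
        have "(LINT s|lborel. norm (complex_of_real (K s) * (complex_of_real (g t) * \<eta> (y - \<theta> * s - t)))) \<le>
            (LINT s|lborel. (?B * g t) * K s)" for t
        proof (rule integral_mono)
          show "integrable lborel (\<lambda>s. (?B * g t) * K s)" using K_int by (rule integrable_mult_right)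
          show "norm (complex_of_real (K s) * (complex_of_real (g t) * \<eta> (y - \<theta> * s - t))) \<le> (?B * g t) * K s" for s
            using mult_left_mono[OF le[of t s] K_nonneg[of s]] K_nonneg[of s]
            by (simp add: norm_mult mult.commute mult.left_commute)
        qed (intro integrable_norm i)
        then have *: "(LINT s|lborel. norm (complex_of_real (K s) * (complex_of_real (g t) * \<eta> (y - \<theta> * s - t)))) \<le> ?B * g t" for t
          using K_one by simp
        show "AE t in lborel. norm (LINT s|lborel. norm (case (t, s) of (t, s) \<Rightarrow>
          complex_of_real (K s) * (complex_of_real (g t) * \<eta> (y - \<theta> * s - t)))) \<le> norm (?B * g t)"
          using order_trans[OF * abs_ge_self] by (intro AE_I2) simp
      qed measurable
    qed measurable
  qed
  also have "\<dots> = (LINT t|lborel. complex_of_real (g t) * a t)"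
  proof (rule Bochner_Integration.integral_cong[OF refl])
    fix t
    have "(LINT s|lborel. complex_of_real (K s) * (complex_of_real (g t) * \<eta> (y - \<theta> * s - t))) =
        (LINT s|lborel. complex_of_real (g t) * (complex_of_real (K s) * \<eta> (y - t - \<theta> * s)))"
      by (intro Bochner_Integration.integral_cong refl) (simp add: diff_diff_eq add.commute mult.left_commute)
    also have "\<dots> = complex_of_real (g t) * a t" unfolding a_def by (rule integral_mult_right_zero)
    finally show "(LINT s|lborel. complex_of_real (K s) * (complex_of_real (g t) * \<eta> (y - \<theta> * s - t))) =
        complex_of_real (g t) * a t" .
  qed
  finally have 1: "kernel_avg K \<theta> (convol f \<psi>) y = (LINT t|lborel. complex_of_real (g t) * a t)" .
  have ia: "integrable lborel (\<lambda>t. complex_of_real (g t) * a t)"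
    by (rule g.integrable_kernel_times[OF _ a_le]) measurable
  have ig: "integrable lborel (\<lambda>t. complex_of_real (g t) * a 0)"
    using g(3) by (intro integrable_mult_left) (auto intro: integrable_of_real)
  have "(LINT t|lborel. complex_of_real (g t) * a 0) = a 0"
    using g(3,4) by simp
  then have "kernel_avg K \<theta> (convol f \<psi>) y - kernel_avg K \<theta> \<psi> y = (LINT t|lborel. complex_of_real (g t) * (a t - a 0))"
    unfolding 1 a0 using Bochner_Integration.integral_diff[OF ia ig] by (simp add: right_diff_distrib)
  also have "norm \<dots> \<le> (LINT t|lborel. ?B * (g t * translation_error K (t / \<theta>)))"
  proof (rule order_trans[OF integral_norm_bound integral_mono])
    show "integrable lborel (\<lambda>t. norm (complex_of_real (g t) * (a t - a 0)))"
      using Bochner_Integration.integrable_diff[OF ia ig] by (intro integrable_norm) (simp add: right_diff_distrib)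
    have "integrable lborel (\<lambda>t. g t * translation_error K (t / \<theta>))"
    proof (rule Bochner_Integration.integrable_bound)
      show "integrable lborel (\<lambda>t. 2 * g t)" using g(3) by simp
      show "AE t in lborel. norm (g t * translation_error K (t / \<theta>)) \<le> norm (2 * g t)"
        using mult_left_mono[OF translation_error_bounds(2) g(2)] translation_error_bounds(1) g(2)
        by (auto simp: abs_mult mult.commute)
    qed measurable
    then show "integrable lborel (\<lambda>t. ?B * (g t * translation_error K (t / \<theta>)))"
      by (rule integrable_mult_right)
    show "norm (complex_of_real (g t) * (a t - a 0)) \<le> ?B * (g t * translation_error K (t / \<theta>))" for t
      using mult_left_mono[OF adiff g(2)[of t]] g(2)[of t] by (simp add: norm_mult mult.left_commute)
  qed
  finally show ?thesis by simp
qed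

end

section \<open>Cluster points and the criterion for almost convergence\<close>

text \<open>A product of closed discs is compact by Tychonoff, so the sequence has a cluster point
  in the topology of pointwise convergence. The filter \<open>G\<close> plays the role of a
  convergent subnet.\<close>

lemma pointwise_bounded_cluster:
  fixes \<Phi> :: "nat \<Rightarrow> 'a \<Rightarrow> complex"
  assumes bd: "\<And>n x. norm (\<Phi> n x) \<le> B x"
  obtains G p where "G \<noteq> bot" "G \<le> sequentially" "\<And>x. ((\<lambda>n. \<Phi> n x) \<longlongrightarrow> p x) G"
proof -
  let ?S = "PiE UNIV (\<lambda>x. cball 0 (B x)) :: ('a \<Rightarrow> complex) set"
  have "compactin (product_topology (\<lambda>_. euclidean) UNIV) ?S"
    by (subst compactin_PiE) auto
  then have "compact ?S" by (simp add: euclidean_product_topology)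
  moreover have "filtermap \<Phi> sequentially \<noteq> bot" by (simp add: filtermap_bot_iff)
  moreover have "eventually (\<lambda>f. f \<in> ?S) (filtermap \<Phi> sequentially)"
    unfolding eventually_filtermap by (rule always_eventually) (simp add: PiE_UNIV_domain bd)
  ultimately obtain p where p: "inf (nhds p) (filtermap \<Phi> sequentially) \<noteq> bot"
    by (auto dest!: compact_filter[THEN iffD1, rule_format])
  \<comment> \<open>Tails of the sequence intersected with preimages of neighbourhoods of
    \<open>p\<close>. That \<open>p\<close> is a cluster point says exactly that no such
    intersection is empty.\<close>
  define G where "G = inf sequentially (filtercomap \<Phi> (nhds p))"
  show thesis
  proof
    show "G \<noteq> bot"
    proof
      assume "G = bot"
      then have "eventually (\<lambda>_. False) G" by simp
      then obtain P Q where PQ: "eventually P sequentially" "eventually Q (filtercomap \<Phi> (nhds p))"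
        "\<And>n. P n \<Longrightarrow> Q n \<Longrightarrow> False"
        unfolding G_def eventually_inf by blast
      obtain R where R: "eventually R (nhds p)" "\<And>n. R (\<Phi> n) \<Longrightarrow> Q n"
        using PQ(2) unfolding eventually_filtercomap by blast
      have "eventually (\<lambda>f. \<not> R f) (filtermap \<Phi> sequentially)"
        unfolding eventually_filtermap using PQ(1) by eventually_elim (use PQ(3) R(2) in blast)
      then have "eventually (\<lambda>_. False) (inf (nhds p) (filtermap \<Phi> sequentially))"
        using R(1) unfolding eventually_inf by blast
      then show False using p by (simp add: trivial_limit_def)
    qed
    show "G \<le> sequentially" by (simp add: G_def)
    have "filterlim \<Phi> (nhds p) G"
      unfolding G_def by (rule filterlim_mono[OF filterlim_filtercomap]) auto
    moreover have "((\<lambda>f. f x) \<longlongrightarrow> p x) (nhds p)" for x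
      using continuous_on_product_coordinates[of x] tendsto_at_iff_tendsto_nhds[of "\<lambda>f. f x" p]
      by (auto simp: continuous_on_def)
    ultimately show "((\<lambda>n. \<Phi> n x) \<longlongrightarrow> p x) G" for x
      by (rule filterlim_compose[rotated])
  qed
qed

lemma almost_convergentD:
  "almost_convergent \<psi> \<alpha> \<Longrightarrow> topologically_invariant_mean \<Phi> \<Longrightarrow> \<Phi> \<psi> = \<alpha>"
  by (simp add: almost_convergent_def)

context prob_kernel
begin

text \<open>Invariance allows \<open>\<psi>\<close> to be replaced by its average at any scale. At a
  large scale the average is within a small constant of \<alpha> in norm, and boundedness of the
  mean passes this on to the value.\<close>

lemma kernel_mean_value:
  assumes \<psi>: "\<psi> \<in> Linfty"
    and lim: "uniform_limit UNIV (\<lambda>\<theta> y. kernel_avg K \<theta> \<psi> y) (\<lambda>y. \<alpha>) at_top"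
    and \<Phi>: "topologically_invariant_mean \<Phi>"
  shows "\<Phi> \<psi> = \<alpha>"
proof -
  have dual: "\<Phi> \<in> Linfty_dual" and one: "\<Phi> (\<lambda>x. 1) = 1"
    and inv: "\<And>f \<eta>. f \<in> prob_densities \<Longrightarrow> \<eta> \<in> Linfty \<Longrightarrow> \<Phi> (convol f \<eta>) = \<Phi> \<eta>"
    using \<Phi> by (auto simp: topologically_invariant_mean_def is_mean_def)
  have add: "\<And>u v. u \<in> Linfty \<Longrightarrow> v \<in> Linfty \<Longrightarrow> \<Phi> (\<lambda>x. u x + v x) = \<Phi> u + \<Phi> v"
    and mult: "\<And>c u. u \<in> Linfty \<Longrightarrow> \<Phi> (\<lambda>x. c * u x) = c * \<Phi> u"
    using dual unfolding Linfty_dual_def by blast+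
  obtain C where C: "\<And>\<eta>. \<eta> \<in> Linfty \<Longrightarrow> norm (\<Phi> \<eta>) \<le> C * Linfty_norm \<eta>"
    using dual unfolding Linfty_dual_def by blast
  have le: "norm (\<Phi> \<psi> - \<alpha>) \<le> e" if e: "e > 0" for e
  proof -
    \<comment> \<open>The constant \<open>C\<close> in the definition of the dual carries no sign
      condition, hence |C| + 1.\<close>
    have "e / (\<bar>C\<bar> + 1) > 0" using e by simp
    then have "\<forall>\<^sub>F \<theta> in at_top. \<forall>y\<in>UNIV. dist (kernel_avg K \<theta> \<psi> y) \<alpha> < e / (\<bar>C\<bar> + 1)"
      using lim by (auto simp: uniform_limit_iff)
    then obtain \<theta> where \<theta>: "\<theta> > 0" "\<And>y. dist (kernel_avg K \<theta> \<psi> y) \<alpha> < e / (\<bar>C\<bar> + 1)"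
      using eventually_happens[OF eventually_conj[OF _ eventually_gt_at_top[of 0]]] trivial_limit_at_top_linorder
      by blast
    let ?f = "\<lambda>t. K (t / \<theta>) / \<theta>"
    let ?c = "convol ?f \<psi>"
    have f: "?f \<in> prob_densities" using \<theta>(1) by (rule scaled_kernel_density)
    have c: "?c \<in> Linfty" using convol_Linfty(1)[OF f \<psi>] .
    \<comment> \<open>The constant is written as a multiple of 1 so that homogeneity and the
      normalisation of the mean evaluate it.\<close>
    have d: "(\<lambda>x. ?c x + (- \<alpha>) * 1) \<in> Linfty"
      using Linfty_add[OF c Linfty_cmult[OF Linfty_const]] .
    have "\<Phi> (\<lambda>x. ?c x + (- \<alpha>) * 1) = \<Phi> ?c + \<Phi> (\<lambda>x. (- \<alpha>) * 1)"
      by (rule add[OF c Linfty_cmult[OF Linfty_const]])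
    also have "\<Phi> (\<lambda>x. (- \<alpha>) * 1) = (- \<alpha>) * \<Phi> (\<lambda>x. 1)"
      by (rule mult[OF Linfty_const])
    finally have "\<Phi> (\<lambda>x. ?c x + (- \<alpha>) * 1) = \<Phi> ?c + (- \<alpha>) * \<Phi> (\<lambda>x. 1)" .
    then have eq: "\<Phi> (\<lambda>x. ?c x + (- \<alpha>) * 1) = \<Phi> \<psi> - \<alpha>"
      using inv[OF f \<psi>] one by simp
    have "norm (?c x + (- \<alpha>) * 1) \<le> e / (\<bar>C\<bar> + 1)" for x
      using \<theta>(2)[of x] convol_scaled_kernel[OF \<psi> \<theta>(1), of x] by (simp add: dist_norm)
    then have "Linfty_norm (\<lambda>x. ?c x + (- \<alpha>) * 1) \<le> e / (\<bar>C\<bar> + 1)"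
      using Linfty_measurable[OF d] by (intro Linfty_norm_le) auto
    then have "\<bar>C\<bar> * Linfty_norm (\<lambda>x. ?c x + (- \<alpha>) * 1) \<le> \<bar>C\<bar> * (e / (\<bar>C\<bar> + 1))"
      by (rule mult_left_mono) simp
    moreover have "C * Linfty_norm (\<lambda>x. ?c x + (- \<alpha>) * 1) \<le> \<bar>C\<bar> * Linfty_norm (\<lambda>x. ?c x + (- \<alpha>) * 1)"
      by (rule mult_right_mono[OF abs_ge_self Linfty_norm_nonneg[OF d]])
    ultimately have "norm (\<Phi> \<psi> - \<alpha>) \<le> \<bar>C\<bar> * (e / (\<bar>C\<bar> + 1))"
      using C[OF d] unfolding eq by linarith
    also have "\<dots> \<le> (\<bar>C\<bar> + 1) * (e / (\<bar>C\<bar> + 1))" using e by (intro mult_right_mono) auto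
    also have "\<dots> = e" by (simp add: add_nonneg_eq_0_iff)
    finally show ?thesis .
  qed
  have "norm (\<Phi> \<psi> - \<alpha>) \<le> 0"
  proof (rule field_le_epsilon)
    fix e :: real assume "e > 0"
    then show "norm (\<Phi> \<psi> - \<alpha>) \<le> 0 + e" using le[of e] by linarith
  qed
  then show ?thesis by simp
qed

text \<open>
  Tychonoff's theorem gives a cluster point of the averaging functionals. It is topologically
  invariant because the dilated kernels are asymptotically translation invariant in \<open>L\<^sup>1\<close>.
\<close>
lemma kernel_cluster_mean:
  assumes cont: "AE s in lborel. isCont K s"
    and \<theta>: "\<And>n. \<theta> n > 0" "filterlim \<theta> at_top sequentially"
  obtains \<Phi> G where "topologically_invariant_mean \<Phi>" "G \<noteq> bot" "G \<le> sequentially"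
    "\<And>\<psi>. \<psi> \<in> Linfty \<Longrightarrow> ((\<lambda>n. kernel_avg K (\<theta> n) \<psi> (y n)) \<longlongrightarrow> \<Phi> \<psi>) G"
proof -
  \<comment> \<open>The value 0 off \<open>Linfty\<close> gives a bound at every function, as the
    compactness lemma requires; the absolute value below keeps the radius nonnegative there
    too.\<close>
  define A where "A = (\<lambda>n \<psi>. if \<psi> \<in> Linfty then kernel_avg K (\<theta> n) \<psi> (y n) else 0)"
  have \<theta>0: "\<theta> n \<noteq> 0" for n using \<theta>(1)[of n] by simp
  have A_le: "norm (A n \<psi>) \<le> \<bar>Linfty_norm \<psi>\<bar>" for n \<psi>
    using kernel_avg_norm_le[OF _ \<theta>0] by (auto simp: A_def intro: order_trans[OF _ abs_ge_self])
  obtain G \<Phi> where G: "G \<noteq> bot" "G \<le> sequentially" and \<Phi>: "\<And>\<psi>. ((\<lambda>n. A n \<psi>) \<longlongrightarrow> \<Phi> \<psi>) G"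
    by (rule pointwise_bounded_cluster[of A "\<lambda>\<psi>. \<bar>Linfty_norm \<psi>\<bar>"], rule A_le, rule that)
  have lim: "((\<lambda>n. kernel_avg K (\<theta> n) \<psi> (y n)) \<longlongrightarrow> \<Phi> \<psi>) G" if "\<psi> \<in> Linfty" for \<psi>
    using \<Phi>[of \<psi>] that by (simp add: A_def)
  note uniq = tendsto_unique[OF G(1)]
  have "\<Phi> \<in> Linfty_dual"
    unfolding Linfty_dual_def
  proof (intro CollectI conjI ballI allI impI)
    show "\<Phi> \<psi> = \<Phi> \<eta>" if "\<psi> \<in> Linfty" "\<eta> \<in> Linfty" "AE x in lebesgue. \<psi> x = \<eta> x" for \<psi> \<eta>
      using uniq[OF lim[OF that(1)]] lim[OF that(2)] kernel_avg_cong_AE[OF that \<theta>0] by simp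
    show "\<Phi> (\<lambda>x. \<psi> x + \<eta> x) = \<Phi> \<psi> + \<Phi> \<eta>" if "\<psi> \<in> Linfty" "\<eta> \<in> Linfty" for \<psi> \<eta>
      using uniq[OF lim[OF Linfty_add[OF that]]] tendsto_add[OF lim[OF that(1)] lim[OF that(2)]]
        kernel_avg_add[OF that \<theta>0] by simp
    show "\<Phi> (\<lambda>x. c * \<psi> x) = c * \<Phi> \<psi>" if "\<psi> \<in> Linfty" for c \<psi>
      using uniq[OF lim[OF Linfty_cmult[OF that]]] tendsto_mult[OF tendsto_const lim[OF that]]
        kernel_avg_cmult by simp
    have "norm (\<Phi> \<psi>) \<le> 1 * Linfty_norm \<psi>" if "\<psi> \<in> Linfty" for \<psi>
      using tendsto_upperbound[OF tendsto_norm[OF lim[OF that]] _ G(1)] kernel_avg_norm_le[OF that \<theta>0] by simp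
    then show "\<exists>C. \<forall>\<psi>\<in>Linfty. norm (\<Phi> \<psi>) \<le> C * Linfty_norm \<psi>" by blast
  qed
  moreover have "\<Phi> \<psi> \<in> \<real>\<^sub>\<ge>\<^sub>0" if "\<psi> \<in> Linfty" "AE x in lebesgue. \<psi> x \<in> \<real>\<^sub>\<ge>\<^sub>0" for \<psi>
    using Lim_in_closed_set[OF closed_nonneg_Reals_complex _ G(1) lim[OF that(1)]]
      kernel_avg_nonneg[OF that \<theta>0] by simp
  moreover have "\<Phi> (\<lambda>x. 1) = 1"
    using uniq[OF lim[OF Linfty_const[of 1]]] by (simp add: kernel_avg_const)
  moreover have "\<Phi> (convol f \<psi>) = \<Phi> \<psi>" if f: "f \<in> prob_densities" and \<psi>: "\<psi> \<in> Linfty" for f \<psi>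
  proof -
    obtain \<eta> where \<eta>: "\<eta> \<in> borel_measurable borel" "\<And>x. norm (\<eta> x) \<le> Linfty_norm \<psi>" "AE x in lebesgue. \<psi> x = \<eta> x"
      using Linfty_borel_version[OF \<psi>] by metis
    obtain g where g: "g \<in> borel_measurable borel" "\<And>x. 0 \<le> g x" "integrable lborel g"
      "(LINT x|lborel. g x) = 1" "AE x in lebesgue. f x = g x"
      using prob_densities_borel_version[OF f] by metis
    have "(\<lambda>n. Linfty_norm \<psi> * (LINT t|lborel. g t * translation_error K (t / \<theta> n))) \<longlonglongrightarrow> Linfty_norm \<psi> * 0"
      by (intro tendsto_mult tendsto_const integral_translation_error_tendsto[OF cont g(3,2) \<theta>(2)])
    then have "(\<lambda>n. Linfty_norm \<psi> * (LINT t|lborel. g t * translation_error K (t / \<theta> n))) \<longlonglongrightarrow> 0" by simp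
    then have "(\<lambda>n. kernel_avg K (\<theta> n) (convol f \<psi>) (y n) - kernel_avg K (\<theta> n) \<psi> (y n)) \<longlonglongrightarrow> 0"
      by (rule Lim_null_comparison[rotated])
        (rule always_eventually, rule allI, rule kernel_avg_convol_diff[OF \<psi> \<theta>(1) \<eta> g])
    \<comment> \<open>The sequential limit persists along the finer filter \<open>G\<close>, along
      which the two averages also converge separately.\<close>
    then have "((\<lambda>n. kernel_avg K (\<theta> n) (convol f \<psi>) (y n) - kernel_avg K (\<theta> n) \<psi> (y n)) \<longlongrightarrow> 0) G"
      using G(2) by (rule tendsto_mono[rotated])
    moreover have "((\<lambda>n. kernel_avg K (\<theta> n) (convol f \<psi>) (y n) - kernel_avg K (\<theta> n) \<psi> (y n)) \<longlongrightarrow> \<Phi> (convol f \<psi>) - \<Phi> \<psi>) G"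
      by (intro tendsto_diff lim convol_Linfty(1)[OF f] \<psi>)
    ultimately show ?thesis using uniq by fastforce
  qed
  ultimately have "topologically_invariant_mean \<Phi>"
    by (simp add: topologically_invariant_mean_def is_mean_def)
  then show thesis using that G lim by blast
qed

text \<open>If uniform convergence fails, there are scales tending to infinity and centres whose
  averages stay at distance at least e from \<alpha>. The invariant mean built along them then also
  differs from \<alpha> at \<open>\<psi>\<close>.\<close>

lemma almost_convergent_iff_kernel_avg:
  assumes cont: "AE s in lborel. isCont K s" and \<psi>: "\<psi> \<in> Linfty"
  shows "almost_convergent \<psi> \<alpha> \<longleftrightarrow>
    uniform_limit UNIV (\<lambda>\<theta> y. kernel_avg K \<theta> \<psi> y) (\<lambda>y. \<alpha>) at_top"
proof
  assume "uniform_limit UNIV (\<lambda>\<theta> y. kernel_avg K \<theta> \<psi> y) (\<lambda>y. \<alpha>) at_top"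
  then show "almost_convergent \<psi> \<alpha>"
    using kernel_mean_value \<psi> by (auto simp: almost_convergent_def)
next
  assume ac: "almost_convergent \<psi> \<alpha>"
  show "uniform_limit UNIV (\<lambda>\<theta> y. kernel_avg K \<theta> \<psi> y) (\<lambda>y. \<alpha>) at_top"
  proof (rule ccontr)
    assume "\<not> ?thesis"
    then obtain e where e: "e > 0"
      and "\<not> (\<forall>\<^sub>F \<theta> in at_top. \<forall>y. dist (kernel_avg K \<theta> \<psi> y) \<alpha> < e)"
      by (auto simp: uniform_limit_iff)
    then have "\<exists>\<theta>\<ge>N. \<exists>y. dist (kernel_avg K \<theta> \<psi> y) \<alpha> \<ge> e" for N
      unfolding eventually_at_top_linorder by (meson not_less)
    \<comment> \<open>The bound n + 1 both drives the scales to infinity and makes every one of them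
      positive, including the first.\<close>
    then have "\<exists>\<theta> y. \<theta> \<ge> real (Suc n) \<and> dist (kernel_avg K \<theta> \<psi> y) \<alpha> \<ge> e" for n by blast
    then obtain \<theta> y where \<theta>: "\<And>n. \<theta> n \<ge> real (Suc n)"
      and far: "\<And>n. dist (kernel_avg K (\<theta> n) \<psi> (y n)) \<alpha> \<ge> e"
      by metis
    have "filterlim (\<lambda>n. real (Suc n)) at_top sequentially"
      by (rule filterlim_compose[OF filterlim_real_sequentially filterlim_Suc])
    then have top: "filterlim \<theta> at_top sequentially"
      by (rule filterlim_at_top_mono) (use \<theta> in simp)
    have pos: "\<theta> n > 0" for n using \<theta>[of n] by (smt (verit) of_nat_0_less_iff zero_less_Suc)
    obtain \<Phi> G where \<Phi>: "topologically_invariant_mean \<Phi>" and G: "G \<noteq> bot"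
      and lim: "((\<lambda>n. kernel_avg K (\<theta> n) \<psi> (y n)) \<longlongrightarrow> \<Phi> \<psi>) G"
      using kernel_cluster_mean[OF cont pos top, where y=y] \<psi> by metis
    have "e \<le> dist (\<Phi> \<psi>) \<alpha>"
      by (rule tendsto_lowerbound[OF tendsto_dist[OF lim tendsto_const] _ G]) (use far in simp)
    then show False using almost_convergentD[OF ac \<Phi>] e by simp
  qed
qed

end

section \<open>The uniform density and the Poisson kernel\<close>

definition box_kernel :: "real \<Rightarrow> real" where
  "box_kernel s = indicator {-1..1} s / 2"

lemma prob_kernel_box: "prob_kernel box_kernel"
proof
  show "box_kernel \<in> borel_measurable borel" unfolding box_kernel_def by measurable
  show "integrable lborel box_kernel" unfolding box_kernel_def by (auto intro!: integrable_real_indicator)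
  show "(LINT s|lborel. box_kernel s) = 1" unfolding box_kernel_def by simp
qed (simp add: box_kernel_def)

text \<open>The jumps at -1 and 1 are the reason why the criterion asks for continuity only almost
  everywhere.\<close>

lemma AE_isCont_box_kernel: "AE s in lborel. isCont box_kernel s"
  using AE_lborel_singleton[of "1::real"] AE_lborel_singleton[of "-1::real"]
proof eventually_elim
  case (elim s)
  have "frontier {-1..1::real} = {-1, 1}" by (simp add: frontier_def)
  then have "isCont (\<lambda>s. indicator {-1..1::real} s :: real) s"
    using elim by (subst isCont_indicator) auto
  then show ?case unfolding box_kernel_def by (intro continuous_intros) auto
qed

lemma kernel_avg_box:
  assumes "\<psi> \<in> Linfty" "\<theta> > 0"
  shows "kernel_avg box_kernel \<theta> \<psi> y =
    1 / complex_of_real (2 * \<theta>) * (LINT t:{y - \<theta>..y + \<theta>}|lebesgue. \<psi> t)"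
proof -
  interpret prob_kernel box_kernel by (rule prob_kernel_box)
  obtain \<eta> where \<eta>: "\<eta> \<in> borel_measurable borel" "AE x in lebesgue. \<psi> x = \<eta> x"
    by (rule Linfty_borel_version[OF assms(1)])
  note [measurable] = \<eta>(1)
  have "AE t in lebesgue. indicator {y - \<theta>..y + \<theta>} t *\<^sub>R \<psi> t = indicator {y - \<theta>..y + \<theta>} t *\<^sub>R \<eta> t"
    using \<eta>(2) by eventually_elim simp
  then have "(LINT t:{y - \<theta>..y + \<theta>}|lebesgue. \<psi> t) = (LINT t|lborel. indicator {y - \<theta>..y + \<theta>} t *\<^sub>R \<eta> t)"
    unfolding set_lebesgue_integral_def by (intro lebesgue_integral_AE_borel) auto
  \<comment> \<open>Substitution t = y - \<theta> s. Its Jacobian \<theta> and the height 1/2 of the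
    density together produce the factor 2 \<theta>.\<close>
  also have "\<dots> = \<bar>- \<theta>\<bar> *\<^sub>R (LINT s|lborel. indicator {y - \<theta>..y + \<theta>} (y + (- \<theta>) * s) *\<^sub>R \<eta> (y + (- \<theta>) * s))"
    using assms(2) by (intro lborel_integral_real_affine) auto
  also have "\<dots> = \<theta> *\<^sub>R (LINT s|lborel. 2 * (complex_of_real (box_kernel s) * \<eta> (y - \<theta> * s)))"
  proof -
    have "indicator {y - \<theta>..y + \<theta>} (y + (- \<theta>) * s) = (indicator {-1..1} s :: real)" for s
    proof -
      have "y + (- \<theta>) * s \<in> {y - \<theta>..y + \<theta>} \<longleftrightarrow> \<theta> * s \<le> \<theta> * 1 \<and> \<theta> * (- 1) \<le> \<theta> * s" by auto
      also have "\<dots> \<longleftrightarrow> s \<in> {-1..1}"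
        using assms(2) by (subst (1 2) mult_le_cancel_left_pos) auto
      finally show ?thesis by (simp add: indicator_def)
    qed
    then have "indicator {y - \<theta>..y + \<theta>} (y + (- \<theta>) * s) *\<^sub>R \<eta> (y + (- \<theta>) * s)
        = 2 * (complex_of_real (box_kernel s) * \<eta> (y - \<theta> * s))" for s
      by (simp add: box_kernel_def scaleR_conv_of_real)
    then show ?thesis using assms(2) by simp
  qed
  also have "\<dots> = complex_of_real (2 * \<theta>) * kernel_avg box_kernel \<theta> \<psi> y"
    using assms(2) by (subst kernel_avg_borel[OF \<eta>]) (auto simp: scaleR_conv_of_real)
  finally show ?thesis using assms(2) by simp
qed

lemma prob_kernel_poisson: "prob_kernel poisson_kernel"
  by unfold_locales (auto intro: poisson_kernel_nonneg integrable_poisson_kernel integral_poisson_kernel)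

lemma AE_isCont_poisson_kernel: "AE s in lborel. isCont poisson_kernel s"
  using continuous_poisson_kernel[of UNIV] by (simp add: continuous_on_eq_continuous_at)

text \<open>With Fatou's theorem available, the shifted Poisson formula passes to the limit e = 0:
  the functions on the lines Re z = e are bounded by \<open>M\<close> and converge almost everywhere
  to the boundary function.\<close>

lemma
  assumes "\<phi> \<in> Hinfty"
  shows boundary_fun_Linfty: "boundary_fun \<phi> \<in> Linfty"
    and poisson_boundary_fun: "x > 0 \<Longrightarrow> kernel_avg poisson_kernel x (boundary_fun \<phi>) y = \<phi> (Complex x y)"
proof -
  obtain M where hol: "\<phi> holomorphic_on \<complex>\<^sup>+" and bd: "\<And>z. Re z > 0 \<Longrightarrow> norm (\<phi> z) \<le> M" and M: "0 \<le> M"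
    using HinftyE[OF assms] by metis
  define e where "e = (\<lambda>n. 1 / real (Suc n))"
  have e: "e n > 0" for n by (simp add: e_def)
  have e0: "e \<longlonglongrightarrow> 0" unfolding e_def by real_asymp
  define u where "u = (\<lambda>n y. \<phi> (Complex (e n) y))"
  have [measurable]: "u n \<in> borel_measurable borel" for n
  proof -
    have "continuous_on UNIV (\<lambda>s. \<phi> (Complex (e n) (0 - (- 1) * s)))"
      by (rule continuous_on_vertical_line[OF hol bd M e])
    then show ?thesis unfolding u_def by (intro borel_measurable_continuous_onI) simp
  qed
  have u_le: "norm (u n y) \<le> M" for n y
    unfolding u_def using e by (intro bd) simp
  have lim: "AE y in lebesgue. (\<lambda>n. u n y) \<longlonglongrightarrow> boundary_fun \<phi> y"
  proof -
    have "AE y in lebesgue. ((\<lambda>x. \<phi> (Complex x y)) \<longlongrightarrow> boundary_fun \<phi> y) (at_right 0)"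
      by (rule AE_boundary_fun[OF hol bd M])
    then show ?thesis
    proof eventually_elim
      case (elim y)
      have "filterlim e (at_right 0) sequentially"
        using e0 e by (auto simp: filterlim_at less_imp_neq[symmetric])
      then show ?case unfolding u_def by (rule filterlim_compose[OF elim])
    qed
  qed
  \<comment> \<open>A pointwise limit of Borel functions taken with \<open>lim\<close> is Borel, so
    \<open>b\<close> is a representative that certifies measurability of the boundary
    function.\<close>
  define b where "b = (\<lambda>y. lim (\<lambda>n. u n y))"
  have [measurable]: "b \<in> borel_measurable borel"
    unfolding b_def by (rule borel_measurable_lim_metric) measurable
  have ae: "AE y in lebesgue. boundary_fun \<phi> y = b y"
    using lim by eventually_elim (simp add: b_def limI)
  show Linf: "boundary_fun \<phi> \<in> Linfty"
  proof (rule LinftyI)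
    show "boundary_fun \<phi> \<in> borel_measurable lebesgue"
      by (rule borel_measurable_lebesgue_AE_eq[OF _ ae]) measurable
    show "AE y in lebesgue. norm (boundary_fun \<phi> y) \<le> M"
      using lim
    proof eventually_elim
      case (elim y)
      show ?case by (rule tendsto_upperbound[OF tendsto_norm[OF elim]]) (auto simp: u_le)
    qed
  qed
  show "kernel_avg poisson_kernel x (boundary_fun \<phi>) y = \<phi> (Complex x y)" if x: "x > 0"
  proof -
    have "(\<lambda>n. LINT s|lebesgue. complex_of_real (poisson_kernel s) * u n (y - x * s)) \<longlonglongrightarrow>
        (LINT s|lebesgue. complex_of_real (poisson_kernel s) * boundary_fun \<phi> (y - x * s))"
    proof (rule integral_dominated_convergence[where w="\<lambda>s. M * poisson_kernel s"])
      have "AE s in lebesgue. boundary_fun \<phi> (y + (- x) * s) = b (y + (- x) * s)"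
        using x by (intro AE_lebesgue_affine[OF ae]) auto
      then have "AE s in lebesgue. complex_of_real (poisson_kernel s) * boundary_fun \<phi> (y - x * s) =
          complex_of_real (poisson_kernel s) * b (y - x * s)"
        by eventually_elim simp
      then show "(\<lambda>s. complex_of_real (poisson_kernel s) * boundary_fun \<phi> (y - x * s)) \<in> borel_measurable lebesgue"
        by (rule borel_measurable_lebesgue_AE_eq[rotated]) measurable
      show "(\<lambda>s. complex_of_real (poisson_kernel s) * u n (y - x * s)) \<in> borel_measurable lebesgue" for n
        by (intro measurable_completion) measurable
      show "integrable lebesgue (\<lambda>s. M * poisson_kernel s)"
        using integrable_poisson_kernel by (subst integrable_completion) auto
      have "AE s in lebesgue. (\<lambda>n. u n (y + (- x) * s)) \<longlonglongrightarrow> boundary_fun \<phi> (y + (- x) * s)"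
        using x by (intro AE_lebesgue_affine[OF lim]) auto
      then show "AE s in lebesgue. (\<lambda>n. complex_of_real (poisson_kernel s) * u n (y - x * s)) \<longlonglongrightarrow>
          complex_of_real (poisson_kernel s) * boundary_fun \<phi> (y - x * s)"
        by eventually_elim (auto intro!: tendsto_mult)
      show "AE s in lebesgue. norm (complex_of_real (poisson_kernel s) * u n (y - x * s)) \<le> M * poisson_kernel s" for n
        using mult_left_mono[OF u_le poisson_kernel_nonneg] poisson_kernel_nonneg
        by (auto simp: norm_mult mult.commute[of M])
    qed
    moreover have "(LINT s|lebesgue. complex_of_real (poisson_kernel s) * u n (y - x * s)) = \<phi> (Complex (e n + x) y)" for n
    proof -
      have "\<phi> (Complex (e n + x) y) = (LINT s|lborel. complex_of_real (poisson_kernel s) * u n (y - x * s))"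
        unfolding u_def by (rule poisson_shifted[OF hol bd M e x])
      moreover have "(LINT s|lebesgue. complex_of_real (poisson_kernel s) * u n (y - x * s)) =
          (LINT s|lborel. complex_of_real (poisson_kernel s) * u n (y - x * s))"
        by (rule integral_completion) measurable
      ultimately show ?thesis by simp
    qed
    moreover have "(\<lambda>n. \<phi> (Complex (e n + x) y)) \<longlonglongrightarrow> \<phi> (Complex x y)"
    proof (rule isCont_tendsto_compose[of _ \<phi>])
      show "isCont \<phi> (Complex x y)"
        using x holomorphic_on_imp_continuous_on[OF hol]
        by (subst (asm) continuous_on_eq_continuous_at)
          (auto simp: right_half_plane_def open_halfspace_Re_gt)
      have "(\<lambda>n. Complex (e n + x) y) \<longlonglongrightarrow> Complex (0 + x) y"
        by (intro tendsto_intros e0)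
      then show "(\<lambda>n. Complex (e n + x) y) \<longlonglongrightarrow> Complex x y" by simp
    qed
    ultimately show ?thesis
      unfolding kernel_avg_def using LIMSEQ_unique by fastforce
  qed
qed

theorem theorem4p2:
  fixes \<phi> :: "complex \<Rightarrow> complex" and \<alpha> :: complex
  assumes "\<phi> \<in> Hinfty"
  shows "(almost_convergent (boundary_fun \<phi>) \<alpha> \<longleftrightarrow>
           uniform_limit UNIV
             (\<lambda>\<theta> y. (1 / complex_of_real (2 * \<theta>)) *
                     (LINT t:{y - \<theta>..y + \<theta>}|lebesgue. boundary_fun \<phi> t))
             (\<lambda>y. \<alpha>) at_top) \<and>
         (almost_convergent (boundary_fun \<phi>) \<alpha> \<longleftrightarrow>
           uniform_limit UNIV (\<lambda>x y. \<phi> (Complex x y)) (\<lambda>y. \<alpha>) at_top)"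
proof
  note Linf = boundary_fun_Linfty[OF assms]
  \<comment> \<open>The averages agree with the Cesaro means only for positive scale, which is
    enough for a limit at infinity; the Poisson case below is the same.\<close>
  have "uniform_limit UNIV (\<lambda>\<theta> y. kernel_avg box_kernel \<theta> (boundary_fun \<phi>) y) (\<lambda>y. \<alpha>) at_top \<longleftrightarrow>
      uniform_limit UNIV (\<lambda>\<theta> y. (1 / complex_of_real (2 * \<theta>)) *
        (LINT t:{y - \<theta>..y + \<theta>}|lebesgue. boundary_fun \<phi> t)) (\<lambda>y. \<alpha>) at_top"
    by (intro uniform_limit_cong eventually_mono[OF eventually_gt_at_top[of 0]]) (simp_all add: kernel_avg_box[OF Linf])
  then show "almost_convergent (boundary_fun \<phi>) \<alpha> \<longleftrightarrow>
      uniform_limit UNIV (\<lambda>\<theta> y. (1 / complex_of_real (2 * \<theta>)) *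
        (LINT t:{y - \<theta>..y + \<theta>}|lebesgue. boundary_fun \<phi> t)) (\<lambda>y. \<alpha>) at_top"
    using prob_kernel.almost_convergent_iff_kernel_avg[OF prob_kernel_box AE_isCont_box_kernel Linf] by simp
  have "uniform_limit UNIV (\<lambda>x y. kernel_avg poisson_kernel x (boundary_fun \<phi>) y) (\<lambda>y. \<alpha>) at_top \<longleftrightarrow>
      uniform_limit UNIV (\<lambda>x y. \<phi> (Complex x y)) (\<lambda>y. \<alpha>) at_top"
    by (intro uniform_limit_cong eventually_mono[OF eventually_gt_at_top[of 0]]) (simp_all add: poisson_boundary_fun[OF assms])
  then show "almost_convergent (boundary_fun \<phi>) \<alpha> \<longleftrightarrow>
      uniform_limit UNIV (\<lambda>x y. \<phi> (Complex x y)) (\<lambda>y. \<alpha>) at_top"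
    using prob_kernel.almost_convergent_iff_kernel_avg[OF prob_kernel_poisson AE_isCont_poisson_kernel Linf] by simp
qed

end
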